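(* Let - (MUC): $(\exists \Omega^{3})(\forall \varphi^{2})(\forall f^{1},g^{1}\leq_1 1)[\overline f\,\Omega(\varphi)=\overline g\,\Omega(\varphi)\to \varphi(f)=\varphi(g)]$; - (MPC)$_0$: $(\exists\Delta^3)(\forall\varphi^2\in C)(\forall f^1,g^1\le_11)[\overline f\Delta(\varphi,f)=\overline g\Delta(\varphi,f)\to\varphi(f)=\varphi(g)]$, where `$\varphi^2\in C$' means that $\varphi$ is pointwise continuous on Cantor space, i.e. $(\forall f^1\le_11)(\exists N^0)(\forall g^1\le_11)(\overline fN=\overline gN\to\varphi(f)=\varphi(g))$; - QF-FAN: for all quantifier-free formulas $A_0(f,n)$, $(\forall f^1\le_11)(\exists n^0)A_0(f,n)\to(\exists k^0)(\forall f^1\le_11)(\exists n\le k)A_0(f,n)$. Then $\mathrm{RCA}_0^\omega+\mathrm{QF\text{-}AC}^{2,0}$ proves $[\mathrm{QF\text{-}FAN}+(\mathrm{MPC})_0]\leftrightarrow\mathrm{MUC}$.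
   Context: Types: $0$ is the type of natural numbers, $\sigma\to\tau$ that of functionals from type $\sigma$ to type $\tau$; $1:=0\to0$, $2:=1\to0$, $3:=2\to0$. Superscripts indicate types; finitely many arguments or values are combined by standard currying/coding (so a functional taking arguments of type $2$ and $1$ to type $0$ is also given type $3$). For $f,g$ of type $1$, $f\le_1g$ means $(\forall n^0)(f(n)\le g(n))$; `$f\le_11$' says that $f$ is a $0/1$-sequence (an element of Cantor space); $\overline fn$ is (the code of) $\langle f(0),\dots,f(n-1)\rangle$. $\mathrm{RCA}_0^\omega$ (Kohlenbach) is $\mathrm{E\text{-}PRA}^\omega+\mathrm{QF\text{-}AC}^{1,0}$. Here $\mathrm{E\text{-}PRA}^\omega$ is classical arithmetic in all finite types with primitive equality $=_0$ only at type $0$ (at higher type, $x=_\tau y$ is defined as $xz_1\dots z_k=_0yz_1\dots z_k$ for all $z_i$), constants for zero, successor, the combinators and primitive recursion with values of type $0$, quantifier-free induction, and the extensionality axiom $x=_\rho y\to\varphi(x)=_\tau\varphi(y)$ for all $\varphi^{\rho\to\tau}$. $\mathrm{QF\text{-}AC}^{\sigma,0}$ is the schema $(\forall x^\sigma)(\exists n^0)A_0(x,n)\to(\exists F^{\sigma\to0})(\forall x^\sigma)A_0(x,F(x))$ for quantifier-free $A_0$. *)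

theory Defs
  imports Main
begin

section \<open>The language of arithmetic in all finite types\<close>

datatype ty = Nat | Fun ty ty (infixr "\<leadsto>" 65)

abbreviation one :: ty where "one \<equiv> Nat \<leadsto> Nat"
abbreviation two :: ty where "two \<equiv> one \<leadsto> Nat"
abbreviation three :: ty where "three \<equiv> two \<leadsto> Nat"

type_synonym var = "string \<times> ty"

text \<open>
  The syntax is locally nameless: \<open>V v\<close> is a named variable that carries its type, \<open>Bnd i\<close> is a
  de Bruijn index, which only occurs below quantifiers. \<open>\<K> \<rho> \<sigma>\<close> and \<open>\<S> \<rho> \<sigma> \<tau>\<close> are the combinators,
  \<open>Rec\<close> is the recursor with values of type \<open>0\<close>.
\<close>

datatype tm =
    V var
  | Bnd nat
  | Zero
  | Succ
  | Comb_K ty ty ("\<K>")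
  | Comb_S ty ty ty ("\<S>")
  | Rec
  | App tm tm (infixl "\<cdot>" 75)

text \<open>The list \<open>\<Gamma>\<close> gives the types of the de Bruijn indices.\<close>

fun tyof :: "ty list \<Rightarrow> tm \<Rightarrow> ty option" where
  "tyof \<Gamma> (V v) = Some (snd v)"
| "tyof \<Gamma> (Bnd i) = (if i < length \<Gamma> then Some (\<Gamma> ! i) else None)"
| "tyof \<Gamma> Zero = Some Nat"
| "tyof \<Gamma> Succ = Some (Nat \<leadsto> Nat)"
| "tyof \<Gamma> (\<K> \<rho> \<sigma>) = Some (\<rho> \<leadsto> \<sigma> \<leadsto> \<rho>)"
| "tyof \<Gamma> (\<S> \<rho> \<sigma> \<tau>) = Some ((\<rho> \<leadsto> \<sigma> \<leadsto> \<tau>) \<leadsto> (\<rho> \<leadsto> \<sigma>) \<leadsto> \<rho> \<leadsto> \<tau>)"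
| "tyof \<Gamma> Rec = Some (Nat \<leadsto> Nat \<leadsto> (Nat \<leadsto> Nat \<leadsto> Nat) \<leadsto> Nat)"
| "tyof \<Gamma> (s \<cdot> t) =
     (case (tyof \<Gamma> s, tyof \<Gamma> t) of
        (Some (\<sigma> \<leadsto> \<tau>), Some \<sigma>') \<Rightarrow> if \<sigma>' = \<sigma> then Some \<tau> else None
      | _ \<Rightarrow> None)"

datatype fm =
    Eq tm tm (infix "\<doteq>" 60)
  | Falsum ("\<^bold>\<bottom>")
  | Imp fm fm (infixr "\<^bold>\<longrightarrow>" 45)
  | All ty fm

fun wff :: "ty list \<Rightarrow> fm \<Rightarrow> bool" where
  "wff \<Gamma> (s \<doteq> t) \<longleftrightarrow> tyof \<Gamma> s = Some Nat \<and> tyof \<Gamma> t = Some Nat"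
| "wff \<Gamma> \<^bold>\<bottom> \<longleftrightarrow> True"
| "wff \<Gamma> (\<phi> \<^bold>\<longrightarrow> \<psi>) \<longleftrightarrow> wff \<Gamma> \<phi> \<and> wff \<Gamma> \<psi>"
| "wff \<Gamma> (All \<tau> \<phi>) \<longleftrightarrow> wff (\<tau> # \<Gamma>) \<phi>"

fun quantifier_free :: "fm \<Rightarrow> bool" where
  "quantifier_free (s \<doteq> t) \<longleftrightarrow> True"
| "quantifier_free \<^bold>\<bottom> \<longleftrightarrow> True"
| "quantifier_free (\<phi> \<^bold>\<longrightarrow> \<psi>) \<longleftrightarrow> quantifier_free \<phi> \<and> quantifier_free \<psi>"
| "quantifier_free (All \<tau> \<phi>) \<longleftrightarrow> False"

fun fv_tm :: "tm \<Rightarrow> var set" where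
  "fv_tm (V v) = {v}"
| "fv_tm (s \<cdot> t) = fv_tm s \<union> fv_tm t"
| "fv_tm _ = {}"

fun fv :: "fm \<Rightarrow> var set" where
  "fv (s \<doteq> t) = fv_tm s \<union> fv_tm t"
| "fv \<^bold>\<bottom> = {}"
| "fv (\<phi> \<^bold>\<longrightarrow> \<psi>) = fv \<phi> \<union> fv \<psi>"
| "fv (All \<tau> \<phi>) = fv \<phi>"

text \<open>
  Abstraction turns the named variable \<open>v\<close> into the index \<open>k\<close>; instantiation replaces the index
  \<open>k\<close> by a term \<open>u\<close>, which is meant to contain no indices (so that nothing is captured).
\<close>

fun abs_tm :: "var \<Rightarrow> nat \<Rightarrow> tm \<Rightarrow> tm" where
  "abs_tm v k (V w) = (if w = v then Bnd k else V w)"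
| "abs_tm v k (s \<cdot> t) = abs_tm v k s \<cdot> abs_tm v k t"
| "abs_tm v k t = t"

fun abs_fm :: "var \<Rightarrow> nat \<Rightarrow> fm \<Rightarrow> fm" where
  "abs_fm v k (s \<doteq> t) = (abs_tm v k s \<doteq> abs_tm v k t)"
| "abs_fm v k \<^bold>\<bottom> = \<^bold>\<bottom>"
| "abs_fm v k (\<phi> \<^bold>\<longrightarrow> \<psi>) = (abs_fm v k \<phi> \<^bold>\<longrightarrow> abs_fm v k \<psi>)"
| "abs_fm v k (All \<tau> \<phi>) = All \<tau> (abs_fm v (Suc k) \<phi>)"

fun inst_tm :: "tm \<Rightarrow> nat \<Rightarrow> tm \<Rightarrow> tm" where
  "inst_tm u k (Bnd i) = (if i = k then u else Bnd i)"
| "inst_tm u k (s \<cdot> t) = inst_tm u k s \<cdot> inst_tm u k t"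
| "inst_tm u k t = t"

fun inst_fm :: "tm \<Rightarrow> nat \<Rightarrow> fm \<Rightarrow> fm" where
  "inst_fm u k (s \<doteq> t) = (inst_tm u k s \<doteq> inst_tm u k t)"
| "inst_fm u k \<^bold>\<bottom> = \<^bold>\<bottom>"
| "inst_fm u k (\<phi> \<^bold>\<longrightarrow> \<psi>) = (inst_fm u k \<phi> \<^bold>\<longrightarrow> inst_fm u k \<psi>)"
| "inst_fm u k (All \<tau> \<phi>) = All \<tau> (inst_fm u (Suc k) \<phi>)"

fun lift :: "tm \<Rightarrow> tm" where
  "lift (Bnd i) = Bnd (Suc i)"
| "lift (s \<cdot> t) = lift s \<cdot> lift t"
| "lift t = t"

definition subst :: "fm \<Rightarrow> var \<Rightarrow> tm \<Rightarrow> fm" ("_[_ \<^bold>:= _]" [90, 0, 0] 90) where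
  "\<phi>[v \<^bold>:= t] = inst_fm t 0 (abs_fm v 0 \<phi>)"

definition Forall :: "var \<Rightarrow> fm \<Rightarrow> fm" ("(3\<^bold>\<forall>_./ _)" [50, 40] 40) where
  "(\<^bold>\<forall>v. \<phi>) = All (snd v) (abs_fm v 0 \<phi>)"

text \<open>The logic is classical, so the remaining connectives are defined.\<close>

definition Neg :: "fm \<Rightarrow> fm" ("\<^bold>\<not> _" [55] 55) where
  "\<^bold>\<not> \<phi> = (\<phi> \<^bold>\<longrightarrow> \<^bold>\<bottom>)"

definition And :: "fm \<Rightarrow> fm \<Rightarrow> fm" (infixr "\<^bold>\<and>" 50) where
  "\<phi> \<^bold>\<and> \<psi> = \<^bold>\<not> (\<phi> \<^bold>\<longrightarrow> \<^bold>\<not> \<psi>)"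

definition Exists :: "var \<Rightarrow> fm \<Rightarrow> fm" ("(3\<^bold>\<exists>_./ _)" [50, 40] 40) where
  "(\<^bold>\<exists>v. \<phi>) = \<^bold>\<not> (\<^bold>\<forall>v. \<^bold>\<not> \<phi>)"


section \<open>Provability\<close>

text \<open>
  A Hilbert calculus for classical many-sorted predicate logic. Formulas in \<open>T\<close> may have free
  variables and are understood universally closed: the rule \<open>Gen\<close> puts no restriction on the
  variables occurring in \<open>T\<close>.
\<close>

inductive proves :: "fm set \<Rightarrow> fm \<Rightarrow> bool" (infix "\<turnstile>" 35) for T :: "fm set" where
  Ax: "\<phi> \<in> T \<Longrightarrow> wff [] \<phi> \<Longrightarrow> T \<turnstile> \<phi>"
| Weak: "wff [] \<phi> \<Longrightarrow> wff [] \<psi> \<Longrightarrow> T \<turnstile> \<phi> \<^bold>\<longrightarrow> \<psi> \<^bold>\<longrightarrow> \<phi>"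
| Distr: "wff [] \<phi> \<Longrightarrow> wff [] \<psi> \<Longrightarrow> wff [] \<chi> \<Longrightarrow>
    T \<turnstile> (\<phi> \<^bold>\<longrightarrow> \<psi> \<^bold>\<longrightarrow> \<chi>) \<^bold>\<longrightarrow> (\<phi> \<^bold>\<longrightarrow> \<psi>) \<^bold>\<longrightarrow> \<phi> \<^bold>\<longrightarrow> \<chi>"
| DNeg: "wff [] \<phi> \<Longrightarrow> T \<turnstile> \<^bold>\<not> \<^bold>\<not> \<phi> \<^bold>\<longrightarrow> \<phi>"
| Inst: "wff [] (All \<tau> \<phi>) \<Longrightarrow> tyof [] t = Some \<tau> \<Longrightarrow> T \<turnstile> All \<tau> \<phi> \<^bold>\<longrightarrow> inst_fm t 0 \<phi>"
| MP: "T \<turnstile> \<phi> \<^bold>\<longrightarrow> \<psi> \<Longrightarrow> T \<turnstile> \<phi> \<Longrightarrow> T \<turnstile> \<psi>"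
| Gen: "T \<turnstile> \<phi> \<^bold>\<longrightarrow> \<psi> \<Longrightarrow> v \<notin> fv \<phi> \<Longrightarrow> T \<turnstile> \<phi> \<^bold>\<longrightarrow> (\<^bold>\<forall>v. \<psi>)"


section \<open>The axioms\<close>

text \<open>Equality at higher types is defined pointwise.\<close>

fun eq_ty :: "ty \<Rightarrow> tm \<Rightarrow> tm \<Rightarrow> fm" where
  "eq_ty Nat s t = (s \<doteq> t)"
| "eq_ty (\<sigma> \<leadsto> \<tau>) s t = All \<sigma> (eq_ty \<tau> (lift s \<cdot> Bnd 0) (lift t \<cdot> Bnd 0))"

inductive_set E_PRA :: "fm set" where
  eq_refl: "(V (''x'', Nat) \<doteq> V (''x'', Nat)) \<in> E_PRA"
| eq_euclid:
    "(V (''x'', Nat) \<doteq> V (''y'', Nat) \<^bold>\<longrightarrow> V (''x'', Nat) \<doteq> V (''z'', Nat)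
       \<^bold>\<longrightarrow> V (''y'', Nat) \<doteq> V (''z'', Nat)) \<in> E_PRA"
| extensionality:
    "(eq_ty \<rho> (V (''x'', \<rho>)) (V (''y'', \<rho>)) \<^bold>\<longrightarrow>
       eq_ty \<tau> (V (''z'', \<rho> \<leadsto> \<tau>) \<cdot> V (''x'', \<rho>)) (V (''z'', \<rho> \<leadsto> \<tau>) \<cdot> V (''y'', \<rho>))) \<in> E_PRA"
| succ_nonzero: "(\<^bold>\<not> Succ \<cdot> V (''x'', Nat) \<doteq> Zero) \<in> E_PRA"
| succ_inj:
    "(Succ \<cdot> V (''x'', Nat) \<doteq> Succ \<cdot> V (''y'', Nat) \<^bold>\<longrightarrow> V (''x'', Nat) \<doteq> V (''y'', Nat)) \<in> E_PRA"
| comb_K: "(eq_ty \<rho> (\<K> \<rho> \<sigma> \<cdot> V (''x'', \<rho>) \<cdot> V (''y'', \<sigma>)) (V (''x'', \<rho>))) \<in> E_PRA"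
| comb_S:
    "(eq_ty \<tau> (\<S> \<rho> \<sigma> \<tau> \<cdot> V (''x'', \<rho> \<leadsto> \<sigma> \<leadsto> \<tau>) \<cdot> V (''y'', \<rho> \<leadsto> \<sigma>) \<cdot> V (''z'', \<rho>))
       (V (''x'', \<rho> \<leadsto> \<sigma> \<leadsto> \<tau>) \<cdot> V (''z'', \<rho>) \<cdot> (V (''y'', \<rho> \<leadsto> \<sigma>) \<cdot> V (''z'', \<rho>)))) \<in> E_PRA"
| rec_zero:
    "(Rec \<cdot> Zero \<cdot> V (''y'', Nat) \<cdot> V (''z'', Nat \<leadsto> Nat \<leadsto> Nat) \<doteq> V (''y'', Nat)) \<in> E_PRA"
| rec_succ:
    "(Rec \<cdot> (Succ \<cdot> V (''x'', Nat)) \<cdot> V (''y'', Nat) \<cdot> V (''z'', Nat \<leadsto> Nat \<leadsto> Nat) \<doteq>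
       V (''z'', Nat \<leadsto> Nat \<leadsto> Nat)
         \<cdot> (Rec \<cdot> V (''x'', Nat) \<cdot> V (''y'', Nat) \<cdot> V (''z'', Nat \<leadsto> Nat \<leadsto> Nat))
         \<cdot> V (''x'', Nat)) \<in> E_PRA"
| qf_induction:
    "quantifier_free A \<Longrightarrow> wff [] A \<Longrightarrow> snd n = Nat \<Longrightarrow>
       (A[n \<^bold>:= Zero] \<^bold>\<and> (\<^bold>\<forall>n. A \<^bold>\<longrightarrow> A[n \<^bold>:= Succ \<cdot> V n]) \<^bold>\<longrightarrow> (\<^bold>\<forall>n. A)) \<in> E_PRA"

text \<open>Quantifier-free formulas may contain parameters of arbitrary types, here and below.\<close>

definition QF_AC :: "ty \<Rightarrow> fm set" where
  "QF_AC \<sigma> =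
     {(\<^bold>\<forall>x. \<^bold>\<exists>n. A) \<^bold>\<longrightarrow> (\<^bold>\<exists>F. \<^bold>\<forall>x. A[n \<^bold>:= V F \<cdot> V x]) | A x n F.
        quantifier_free A \<and> wff [] A \<and> snd x = \<sigma> \<and> snd n = Nat \<and> x \<noteq> n \<and>
        snd F = \<sigma> \<leadsto> Nat \<and> F \<notin> fv A}"

definition RCA0_omega :: "fm set" where
  "RCA0_omega = E_PRA \<union> QF_AC one"


section \<open>Defined arithmetic\<close>

text \<open>
  Bracket abstraction: \<open>lam v t\<close> is the combinatory term for \<open>\<lambda>v. t\<close>. It is used only to build
  closed terms, hence without any danger of variable capture.
\<close>

fun lam :: "var \<Rightarrow> tm \<Rightarrow> tm" where
  "lam v (V w) =
     (if w = v then \<S> (snd v) (snd v \<leadsto> snd v) (snd v) \<cdot> \<K> (snd v) (snd v \<leadsto> snd v) \<cdot> \<K> (snd v) (snd v)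
      else \<K> (snd w) (snd v) \<cdot> V w)"
| "lam v (s \<cdot> t) =
     (if v \<notin> fv_tm (s \<cdot> t) then \<K> (the (tyof [] (s \<cdot> t))) (snd v) \<cdot> (s \<cdot> t)
      else \<S> (snd v) (the (tyof [] t)) (the (tyof [] (s \<cdot> t))) \<cdot> lam v s \<cdot> lam v t)"
| "lam v c = \<K> (the (tyof [] c)) (snd v) \<cdot> c"

definition pred_tm :: tm where
  "pred_tm = (let x = (''x'', Nat); u = (''u'', Nat); i = (''i'', Nat) in
     lam x (Rec \<cdot> V x \<cdot> Zero \<cdot> lam u (lam i (V i))))"

text \<open>Cut-off subtraction\<close>

definition monus_tm :: tm where
  "monus_tm = (let x = (''x'', Nat); y = (''y'', Nat); u = (''u'', Nat); i = (''i'', Nat) in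
     lam x (lam y (Rec \<cdot> V y \<cdot> V x \<cdot> lam u (lam i (pred_tm \<cdot> V u)))))"

definition add_tm :: tm where
  "add_tm = (let x = (''x'', Nat); y = (''y'', Nat); u = (''u'', Nat); i = (''i'', Nat) in
     lam x (lam y (Rec \<cdot> V y \<cdot> V x \<cdot> lam u (lam i (Succ \<cdot> V u)))))"

text \<open>Cantor's pairing \<open>(x, y) \<mapsto> (0 + 1 + \<dots> + (x + y)) + y\<close>\<close>

definition triangle_tm :: tm where
  "triangle_tm = (let x = (''x'', Nat); u = (''u'', Nat); i = (''i'', Nat) in
     lam x (Rec \<cdot> V x \<cdot> Zero \<cdot> lam u (lam i (add_tm \<cdot> V u \<cdot> (Succ \<cdot> V i)))))"

definition pair_tm :: tm where
  "pair_tm = (let x = (''x'', Nat); y = (''y'', Nat) in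
     lam x (lam y (add_tm \<cdot> (triangle_tm \<cdot> (add_tm \<cdot> V x \<cdot> V y)) \<cdot> V y)))"

text \<open>
  Finite sequences are coded by \<open>\<langle>\<rangle> = 0\<close> and \<open>s * \<langle>x\<rangle> = Succ (pair s x)\<close>; \<open>initial f n\<close> is the code of
  \<open>\<langle>f 0, \<dots>, f (n - 1)\<rangle>\<close>.
\<close>

definition initial_tm :: tm where
  "initial_tm = (let f = (''f'', one); n = (''n'', Nat); u = (''u'', Nat); i = (''i'', Nat) in
     lam f (lam n (Rec \<cdot> V n \<cdot> Zero \<cdot> lam u (lam i (Succ \<cdot> (pair_tm \<cdot> V u \<cdot> (V f \<cdot> V i)))))))"

definition initial :: "tm \<Rightarrow> tm \<Rightarrow> tm" where
  "initial f n = initial_tm \<cdot> f \<cdot> n"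

definition le0 :: "tm \<Rightarrow> tm \<Rightarrow> fm" (infix "\<^bold>\<le>" 60) where
  "s \<^bold>\<le> t = (monus_tm \<cdot> s \<cdot> t \<doteq> Zero)"

definition le1 :: "tm \<Rightarrow> tm \<Rightarrow> fm" (infix "\<^bold>\<le>\<^sub>1" 60) where
  "f \<^bold>\<le>\<^sub>1 g = All Nat (lift f \<cdot> Bnd 0 \<^bold>\<le> lift g \<cdot> Bnd 0)"

definition const_one :: tm where
  "const_one = \<K> Nat Nat \<cdot> (Succ \<cdot> Zero)"


section \<open>The principles\<close>

definition MUC :: fm where
  "MUC = (let \<Omega> = (''Omega'', three); \<phi> = (''phi'', two); f = (''f'', one); g = (''g'', one) in
     \<^bold>\<exists>\<Omega>. \<^bold>\<forall>\<phi>. \<^bold>\<forall>f. V f \<^bold>\<le>\<^sub>1 const_one \<^bold>\<longrightarrow> (\<^bold>\<forall>g. V g \<^bold>\<le>\<^sub>1 const_one \<^bold>\<longrightarrow>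
       initial (V f) (V \<Omega> \<cdot> V \<phi>) \<doteq> initial (V g) (V \<Omega> \<cdot> V \<phi>) \<^bold>\<longrightarrow>
       V \<phi> \<cdot> V f \<doteq> V \<phi> \<cdot> V g))"

text \<open>\<open>cont_on_Cantor \<phi>\<close> is to be used for terms \<open>\<phi>\<close> without the variables bound in it.\<close>

definition cont_on_Cantor :: "tm \<Rightarrow> fm" where
  "cont_on_Cantor \<phi> = (let f = (''f'', one); g = (''g'', one); N = (''N'', Nat) in
     \<^bold>\<forall>f. V f \<^bold>\<le>\<^sub>1 const_one \<^bold>\<longrightarrow> (\<^bold>\<exists>N. \<^bold>\<forall>g. V g \<^bold>\<le>\<^sub>1 const_one \<^bold>\<longrightarrow>
       initial (V f) (V N) \<doteq> initial (V g) (V N) \<^bold>\<longrightarrow> \<phi> \<cdot> V f \<doteq> \<phi> \<cdot> V g))"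

definition MPC0 :: fm where
  "MPC0 = (let \<Delta> = (''Delta'', two \<leadsto> one \<leadsto> Nat); \<phi> = (''phi'', two);
               f = (''f'', one); g = (''g'', one) in
     \<^bold>\<exists>\<Delta>. \<^bold>\<forall>\<phi>. cont_on_Cantor (V \<phi>) \<^bold>\<longrightarrow>
       (\<^bold>\<forall>f. V f \<^bold>\<le>\<^sub>1 const_one \<^bold>\<longrightarrow> (\<^bold>\<forall>g. V g \<^bold>\<le>\<^sub>1 const_one \<^bold>\<longrightarrow>
         initial (V f) (V \<Delta> \<cdot> V \<phi> \<cdot> V f) \<doteq> initial (V g) (V \<Delta> \<cdot> V \<phi> \<cdot> V f) \<^bold>\<longrightarrow>
         V \<phi> \<cdot> V f \<doteq> V \<phi> \<cdot> V g)))"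

definition QF_FAN :: "fm set" where
  "QF_FAN =
     {(\<^bold>\<forall>f. V f \<^bold>\<le>\<^sub>1 const_one \<^bold>\<longrightarrow> (\<^bold>\<exists>n. A)) \<^bold>\<longrightarrow>
      (\<^bold>\<exists>k. \<^bold>\<forall>f. V f \<^bold>\<le>\<^sub>1 const_one \<^bold>\<longrightarrow> (\<^bold>\<exists>n. V n \<^bold>\<le> V k \<^bold>\<and> A)) | A f n k.
        quantifier_free A \<and> wff [] A \<and> snd f = one \<and> snd n = Nat \<and>
        snd k = Nat \<and> k \<noteq> n \<and> k \<notin> fv A}"

lemma fv_tm_lam [simp]: "fv_tm (lam v t) = fv_tm t - {v}"
  by (induction t) auto

lemma closed_tms [simp]:
  "fv_tm pred_tm = {}" "fv_tm monus_tm = {}" "fv_tm add_tm = {}" "fv_tm triangle_tm = {}"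
  "fv_tm pair_tm = {}" "fv_tm initial_tm = {}" "fv_tm const_one = {}"
proof -
  show [simp]: "fv_tm pred_tm = {}" "fv_tm add_tm = {}" "fv_tm const_one = {}"
    by (auto simp: pred_tm_def add_tm_def const_one_def Let_def simp del: lam.simps)
  show "fv_tm monus_tm = {}" and [simp]: "fv_tm triangle_tm = {}"
    by (auto simp: monus_tm_def triangle_tm_def Let_def simp del: lam.simps)
  show [simp]: "fv_tm pair_tm = {}"
    by (auto simp: pair_tm_def Let_def simp del: lam.simps)
  show "fv_tm initial_tm = {}"
    by (auto simp: initial_tm_def Let_def simp del: lam.simps)
qed

lemma abs_tm_closed [simp]: "fv_tm t = {} \<Longrightarrow> abs_tm v k t = t"
  by (induction t) auto

lemma lam_closed [simp]: "fv_tm t = {} \<Longrightarrow> lam v t = \<K> (the (tyof [] t)) (snd v) \<cdot> t"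
  by (cases t) auto

lemma tyof_pred_tm [simp]: "tyof \<Gamma> pred_tm = Some one"
  by (simp add: pred_tm_def Let_def)

lemma tyof_monus_tm [simp]: "tyof \<Gamma> monus_tm = Some (Nat \<leadsto> Nat \<leadsto> Nat)"
  by (simp add: monus_tm_def Let_def)

lemma tyof_add_tm [simp]: "tyof \<Gamma> add_tm = Some (Nat \<leadsto> Nat \<leadsto> Nat)"
  by (simp add: add_tm_def Let_def)

lemma tyof_triangle_tm [simp]: "tyof \<Gamma> triangle_tm = Some one"
  by (simp add: triangle_tm_def Let_def)

lemma tyof_pair_tm [simp]: "tyof \<Gamma> pair_tm = Some (Nat \<leadsto> Nat \<leadsto> Nat)"
  by (simp add: pair_tm_def Let_def)

lemma tyof_initial_tm [simp]: "tyof \<Gamma> initial_tm = Some (one \<leadsto> Nat \<leadsto> Nat)"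
  by (simp add: initial_tm_def Let_def)

lemma tyof_const_one [simp]: "tyof \<Gamma> const_one = Some one"
  by (simp add: const_one_def)

lemma MUC_sentence: "wff [] MUC" "fv MUC = {}"
  by (simp_all add: MUC_def Let_def Forall_def Exists_def Neg_def le1_def le0_def initial_def
      const_one_def)

lemma MPC0_sentence: "wff [] MPC0" "fv MPC0 = {}"
  by (simp_all add: MPC0_def cont_on_Cantor_def Let_def Forall_def Exists_def Neg_def le1_def
      le0_def initial_def const_one_def)

end

theory Submission
  imports Defs "HOL-Library.Countable"
begin

text \<open>
  Formal derivations are replaced by semantic arguments. The calculus is complete for extensional
  many-sorted frames in which \<open>\<doteq>\<close> is interpreted by equality (\<open>completeness\<close>, by a Henkin
  construction followed by the quotient of the terms by the equality that the Henkin set contains).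
  It therefore suffices to show that both implications hold in every model of the theories in question. Such a model may be
  nonstandard, and only quantifier-free induction is at hand in it. That is enough for the few facts of
  arithmetic required: the order of the numbers is linear, pairing is injective, and \<open>initial f n\<close>
  determines, and is determined by, the values of \<open>f\<close> below \<open>n\<close>.

  For the direction from \<open>QF_FAN\<close> and \<open>MPC0\<close> to \<open>MUC\<close>, let \<open>\<phi>\<close> be of type 2 and \<open>f\<close> in Cantor space.
  By extensionality each \<open>g\<close> in Cantor space either satisfies \<open>\<phi> g = \<phi> f\<close> or differs from \<open>f\<close>
  somewhere. The fan theorem bounds the place of difference, and the bound is a modulus of continuity
  of \<open>\<phi>\<close> at \<open>f\<close> (\<open>fan_continuous\<close>). So \<open>\<Delta> \<phi>\<close> consists of pointwise moduli for every \<open>\<phi>\<close>, and another use of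
  the fan theorem bounds \<open>\<Delta> \<phi>\<close> on Cantor space by some \<open>c\<close>, which is a uniform modulus. To choose a
  uniform modulus as a function of \<open>\<phi>\<close>, a quantifier-free sufficient condition is needed. Let
  \<open>gap \<phi> k\<close> be the functional that skips the first \<open>k\<close> values of its argument and measures how much
  \<open>\<phi>\<close> changes when the remaining sequence is truncated at \<open>k\<close>. If \<open>\<Delta> (gap \<phi> k) 0 \<le> k\<close>, where \<open>0\<close>
  is the zero sequence, then \<open>gap \<phi> k\<close> vanishes on all arguments in Cantor space that begin with \<open>k\<close>
  zeros, hence \<open>\<phi>\<close> does not notice truncation at \<open>k\<close>, which makes \<open>k\<close> a uniform modulus.
  Conversely, for \<open>k \<ge> c\<close> the functional \<open>gap \<phi> k\<close>
  is constantly zero, so by extensionality \<open>\<Delta> (gap \<phi> k) 0\<close> is the same number \<open>d\<close> for all these \<open>k\<close>, and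
  \<open>k = c + d\<close> satisfies the condition. Now \<open>QF_AC two\<close> yields \<open>\<Omega>\<close> (\<open>MPC0_imp_MUC\<close>).

  Conversely, \<open>MPC0\<close> follows from \<open>MUC\<close> with \<open>\<Delta> \<phi> f = \<Omega> \<phi>\<close>. For the fan theorem, \<open>QF_AC one\<close>
  provides a functional \<open>F\<close> of witnesses, and a bound for \<open>F\<close> on Cantor space can be read off from \<open>\<Omega>\<close>
  (\<open>uniform_modulus_bounded\<close>): if \<open>m\<close> is a uniform modulus of \<open>F\<close>, then the functional
  \<open>z \<mapsto> z (F z + m)\<close> depends on the value of \<open>z\<close> at \<open>F z + m\<close>, so its uniform modulus exceeds \<open>F z\<close>.
\<close>

section \<open>Types under abstraction and instantiation\<close>

lemma tyof_App_eq_Some [simp]: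
  "tyof \<Gamma> (s \<cdot> t) = Some \<tau> \<longleftrightarrow> (\<exists>\<sigma>. tyof \<Gamma> s = Some (\<sigma> \<leadsto> \<tau>) \<and> tyof \<Gamma> t = Some \<sigma>)"
  by (auto split: option.splits ty.splits)

text \<open>
  The rule above replaces the defining equation, whose case distinction clutters every goal.
\<close>

declare tyof.simps(8) [simp del]

lemma tyof_append: "tyof \<Gamma> t = Some \<tau> \<Longrightarrow> tyof (\<Gamma> @ \<Delta>) t = Some \<tau>"
  by (induction t arbitrary: \<tau>) (auto split: if_splits simp: nth_append)

lemma tyof_closed: "tyof [] t = Some \<tau> \<Longrightarrow> tyof \<Gamma> t = Some \<tau>"
  using tyof_append [of "[]" t \<tau> \<Gamma>] by simp

lemma tyof_abs: "tyof \<Gamma> t = Some \<tau> \<Longrightarrow> tyof (\<Gamma> @ [snd v]) (abs_tm v (length \<Gamma>) t) = Some \<tau>"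
  by (induction t arbitrary: \<tau>)
    (auto split: if_splits simp: nth_append)

lemma tyof_inst:
  assumes "tyof [] u = Some \<sigma>"
  shows "tyof (\<Gamma> @ [\<sigma>]) t = Some \<tau> \<Longrightarrow> tyof \<Gamma> (inst_tm u (length \<Gamma>) t) = Some \<tau>"
proof (induction t arbitrary: \<tau>)
  case (Bnd i)
  then show ?case using tyof_closed[OF assms, of \<Gamma>] by (auto simp: nth_append split: if_splits)
qed auto

lemma wff_abs: "wff \<Gamma> \<phi> \<Longrightarrow> wff (\<Gamma> @ [snd v]) (abs_fm v (length \<Gamma>) \<phi>)"
proof (induction \<phi> arbitrary: \<Gamma>)
  case (All \<tau> \<phi>)
  then show ?case using All.IH[of "\<tau> # \<Gamma>"] by simp
qed (auto simp: tyof_abs)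

lemma wff_inst:
  assumes "tyof [] u = Some \<sigma>"
  shows "wff (\<Gamma> @ [\<sigma>]) \<phi> \<Longrightarrow> wff \<Gamma> (inst_fm u (length \<Gamma>) \<phi>)"
proof (induction \<phi> arbitrary: \<Gamma>)
  case (All \<tau> \<phi>)
  then show ?case using All.IH[of "\<tau> # \<Gamma>"] by simp
qed (auto simp: tyof_inst[OF assms])

lemma wff_Forall: "wff [] \<phi> \<Longrightarrow> wff [] (\<^bold>\<forall>v. \<phi>)"
  using wff_abs [of "[]"] by (simp add: Forall_def)

lemma wff_subst: "wff [] \<phi> \<Longrightarrow> tyof [] t = Some (snd v) \<Longrightarrow> wff [] (\<phi>[v \<^bold>:= t])"
  using wff_abs [of "[]" \<phi> v] wff_inst [of t "snd v" "[]"] by (simp add: subst_def)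

lemma wff_Neg [simp]: "wff \<Gamma> (\<^bold>\<not> \<phi>) = wff \<Gamma> \<phi>"
  and wff_And [simp]: "wff \<Gamma> (\<phi> \<^bold>\<and> \<psi>) \<longleftrightarrow> wff \<Gamma> \<phi> \<and> wff \<Gamma> \<psi>"
  and wff_Exists: "wff [] \<phi> \<Longrightarrow> wff [] (\<^bold>\<exists>v. \<phi>)"
  using wff_Forall[of "\<phi> \<^bold>\<longrightarrow> \<^bold>\<bottom>"] by (simp_all add: Neg_def And_def Exists_def)

lemma inst_tm_closed: "tyof \<Gamma> t = Some \<tau> \<Longrightarrow> length \<Gamma> \<le> k \<Longrightarrow> inst_tm u k t = t"
  by (induction t arbitrary: \<tau>) (auto split: if_splits)

lemma inst_abs_tm: "tyof \<Gamma> t = Some \<tau> \<Longrightarrow> length \<Gamma> \<le> k \<Longrightarrow> inst_tm (V v) k (abs_tm v k t) = t"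
  by (induction t arbitrary: \<tau>) (auto split: if_splits)

lemma inst_abs: "wff \<Gamma> \<phi> \<Longrightarrow> length \<Gamma> \<le> k \<Longrightarrow> inst_fm (V v) k (abs_fm v k \<phi>) = \<phi>"
  by (induction \<phi> arbitrary: \<Gamma> k) (auto dest: inst_abs_tm)

lemma abs_inst_tm: "v \<notin> fv_tm t \<Longrightarrow> abs_tm v k (inst_tm (V v) k t) = t"
  by (induction t) auto

lemma abs_inst: "v \<notin> fv \<phi> \<Longrightarrow> abs_fm v k (inst_fm (V v) k \<phi>) = \<phi>"
  by (induction \<phi> arbitrary: k) (auto simp: abs_inst_tm)

lemma finite_fv_tm [simp]: "finite (fv_tm t)" by (induction t) auto
lemma finite_fv [simp]: "finite (fv \<phi>)" by (induction \<phi>) auto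

lemma proves_wff: "T \<turnstile> \<phi> \<Longrightarrow> wff [] \<phi>"
proof (induction rule: proves.induct)
  case (Inst \<tau> \<phi> t)
  then show ?case using wff_inst[of t \<tau> "[]" \<phi>] by simp
next
  case (Gen \<phi> \<psi> v)
  then show ?case using wff_Forall by simp
qed auto

section \<open>Derivations from hypotheses\<close>

text \<open>
  Hypotheses in \<open>\<Gamma>\<close> are local assumptions: modus ponens is the only rule that may use them, and
  generalisation is confined to theorems of \<open>T\<close>. This is what makes the deduction theorem hold
  although \<open>Gen\<close> treats the variables of \<open>T\<close> as universally quantified.
\<close>

inductive entails :: "fm set \<Rightarrow> fm set \<Rightarrow> fm \<Rightarrow> bool" for T \<Gamma> :: "fm set" where
  Thm: "T \<turnstile> \<phi> \<Longrightarrow> entails T \<Gamma> \<phi>"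
| Hyp: "\<phi> \<in> \<Gamma> \<Longrightarrow> wff [] \<phi> \<Longrightarrow> entails T \<Gamma> \<phi>"
| MP: "entails T \<Gamma> (\<phi> \<^bold>\<longrightarrow> \<psi>) \<Longrightarrow> entails T \<Gamma> \<phi> \<Longrightarrow> entails T \<Gamma> \<psi>"

lemma entails_wff: "entails T \<Gamma> \<phi> \<Longrightarrow> wff [] \<phi>"
  by (induction rule: entails.induct) (auto dest: proves_wff)

lemma entails_mono: "entails T \<Gamma> \<phi> \<Longrightarrow> \<Gamma> \<subseteq> \<Delta> \<Longrightarrow> entails T \<Delta> \<phi>"
  by (induction rule: entails.induct) (auto intro: entails.intros)

lemma entails_empty: "entails T {} \<phi> \<Longrightarrow> T \<turnstile> \<phi>"
  by (induction rule: entails.induct) (auto intro: proves.MP)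

lemma proves_refl: "wff [] \<phi> \<Longrightarrow> T \<turnstile> \<phi> \<^bold>\<longrightarrow> \<phi>"
  using proves.Weak[of \<phi> "\<phi> \<^bold>\<longrightarrow> \<phi>" T] proves.Weak[of \<phi> \<phi> T]
    proves.Distr[of \<phi> "\<phi> \<^bold>\<longrightarrow> \<phi>" \<phi> T] by (auto intro: proves.MP)

lemma deduction:
  assumes "entails T (insert \<alpha> \<Gamma>) \<phi>" and \<alpha>: "wff [] \<alpha>"
  shows "entails T \<Gamma> (\<alpha> \<^bold>\<longrightarrow> \<phi>)"
  using assms(1)
proof (induction rule: entails.induct)
  case (Thm \<phi>)
  then show ?case using \<alpha> by (meson entails.simps proves.Weak proves_wff)
next
  case (Hyp \<phi>)
  then show ?case using \<alpha> by (metis entails.simps insertE proves.Weak proves_refl)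
next
  case (MP \<phi> \<psi>)
  then have "wff [] \<phi>" "wff [] \<psi>" using entails_wff by fastforce+
  then show ?case using MP \<alpha> by (meson entails.simps proves.Distr)
qed

lemma entails_dneg: "entails T (insert (\<^bold>\<not> \<phi>) \<Gamma>) \<^bold>\<bottom> \<Longrightarrow> wff [] \<phi> \<Longrightarrow> entails T \<Gamma> \<phi>"
  by (metis Neg_def deduction entails.simps proves.DNeg wff_Neg)

lemma entails_falsum: "entails T \<Gamma> \<^bold>\<bottom> \<Longrightarrow> wff [] \<phi> \<Longrightarrow> entails T \<Gamma> \<phi>"
  by (rule entails_dneg) (auto intro: entails_mono)

lemma entails_AndD:
  assumes "wff [] \<phi>" "wff [] \<psi>"
  shows "entails T {\<phi> \<^bold>\<and> \<psi>} \<phi>" "entails T {\<phi> \<^bold>\<and> \<psi>} \<psi>"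
proof -
  have neg: "entails T \<Gamma> \<^bold>\<bottom>" if "(\<phi> \<^bold>\<and> \<psi>) \<in> \<Gamma>" "entails T \<Gamma> (\<phi> \<^bold>\<longrightarrow> \<^bold>\<not> \<psi>)" for \<Gamma>
    using that assms entails.MP[OF _ that(2), of "\<^bold>\<bottom>"] entails.Hyp[of "\<phi> \<^bold>\<and> \<psi>" \<Gamma> T]
    by (simp add: And_def Neg_def)
  have "entails T {\<phi>, \<^bold>\<not> \<phi>, \<phi> \<^bold>\<and> \<psi>} \<^bold>\<bottom>"
    using assms by (intro entails.MP[of T _ \<phi> "\<^bold>\<bottom>"] entails.Hyp) (simp_all add: Neg_def)
  then have "entails T {\<phi>, \<^bold>\<not> \<phi>, \<phi> \<^bold>\<and> \<psi>} (\<^bold>\<not> \<psi>)"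
    by (rule entails_falsum) (simp add: assms)
  then have "entails T {\<^bold>\<not> \<phi>, \<phi> \<^bold>\<and> \<psi>} (\<phi> \<^bold>\<longrightarrow> \<^bold>\<not> \<psi>)"
    by (rule deduction) (rule assms)
  then have "entails T {\<^bold>\<not> \<phi>, \<phi> \<^bold>\<and> \<psi>} \<^bold>\<bottom>" by (rule neg[rotated]) simp
  then show "entails T {\<phi> \<^bold>\<and> \<psi>} \<phi>" by (rule entails_dneg) (rule assms)
  have "entails T {\<phi>, \<^bold>\<not> \<psi>, \<phi> \<^bold>\<and> \<psi>} (\<^bold>\<not> \<psi>)"
    using assms by (intro entails.Hyp) simp_all
  then have "entails T {\<^bold>\<not> \<psi>, \<phi> \<^bold>\<and> \<psi>} (\<phi> \<^bold>\<longrightarrow> \<^bold>\<not> \<psi>)"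
    by (rule deduction) (rule assms)
  then have "entails T {\<^bold>\<not> \<psi>, \<phi> \<^bold>\<and> \<psi>} \<^bold>\<bottom>" by (rule neg[rotated]) simp
  then show "entails T {\<phi> \<^bold>\<and> \<psi>} \<psi>" by (rule entails_dneg) (rule assms)
qed

lemma entails_AndI:
  assumes "wff [] \<phi>" "wff [] \<psi>"
  shows "entails T {\<phi>, \<psi>} (\<phi> \<^bold>\<and> \<psi>)"
proof -
  have "entails T {\<phi> \<^bold>\<longrightarrow> \<^bold>\<not> \<psi>, \<phi>, \<psi>} \<^bold>\<bottom>"
    using assms
    by (intro entails.MP[of T _ \<psi> "\<^bold>\<bottom>"] entails.MP[of T _ \<phi> "\<psi> \<^bold>\<longrightarrow> \<^bold>\<bottom>"] entails.Hyp)
      (simp_all add: Neg_def)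
  then show ?thesis using assms deduction by (simp add: And_def Neg_def)
qed

lemma proves_Forall:
  assumes "T \<turnstile> \<phi>"
  shows "T \<turnstile> (\<^bold>\<forall>v. \<phi>)"
proof -
  have "T \<turnstile> (\<^bold>\<bottom> \<^bold>\<longrightarrow> \<^bold>\<bottom>) \<^bold>\<longrightarrow> \<phi>"
    using proves.MP[OF proves.Weak assms] proves_wff[OF assms] by simp
  then have "T \<turnstile> (\<^bold>\<bottom> \<^bold>\<longrightarrow> \<^bold>\<bottom>) \<^bold>\<longrightarrow> (\<^bold>\<forall>v. \<phi>)" by (rule proves.Gen) simp
  then show ?thesis by (rule proves.MP) (simp add: proves_refl)
qed

lemma proves_Forall_elim: "wff [] \<phi> \<Longrightarrow> T \<turnstile> (\<^bold>\<forall>v. \<phi>) \<^bold>\<longrightarrow> \<phi>"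
  using proves.Inst[of "snd v" "abs_fm v 0 \<phi>" "V v" T] wff_Forall[of \<phi> v] inst_abs[of "[]" \<phi> 0 v]
  by (simp add: Forall_def)

lemma fv_abs_tm [simp]: "fv_tm (abs_tm v k t) = fv_tm t - {v}"
  by (induction t) auto

lemma fv_abs [simp]: "fv (abs_fm v k \<phi>) = fv \<phi> - {v}"
  by (induction \<phi> arbitrary: k) auto

lemma fv_Forall [simp]: "fv (\<^bold>\<forall>v. \<phi>) = fv \<phi> - {v}"
  by (simp add: Forall_def)

text \<open>
  The rule \<open>Gen\<close> generalises behind one premise only, so the two premises are packed into a
  conjunction first and unpacked afterwards.
\<close>

lemma proves_Forall_Imp:
  assumes \<phi>: "wff [] \<phi>" and \<psi>: "wff [] \<psi>"
  shows "T \<turnstile> (\<^bold>\<forall>v. \<phi> \<^bold>\<longrightarrow> \<psi>) \<^bold>\<longrightarrow> (\<^bold>\<forall>v. \<phi>) \<^bold>\<longrightarrow> (\<^bold>\<forall>v. \<psi>)"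
proof -
  define \<alpha> \<beta> where \<alpha>: "\<alpha> = (\<^bold>\<forall>v. \<phi> \<^bold>\<longrightarrow> \<psi>)" and \<beta>: "\<beta> = (\<^bold>\<forall>v. \<phi>)"
  have wf: "wff [] \<alpha>" "wff [] \<beta>" using assms wff_Forall by (auto simp: \<alpha> \<beta>)
  have "entails T {\<alpha> \<^bold>\<and> \<beta>} (\<phi> \<^bold>\<longrightarrow> \<psi>)"
    using entails_AndD(1)[OF wf] proves_Forall_elim[of "\<phi> \<^bold>\<longrightarrow> \<psi>" T v] assms unfolding \<alpha>
    by (auto intro: entails.MP entails.Thm)
  moreover have "entails T {\<alpha> \<^bold>\<and> \<beta>} \<phi>"
    using entails_AndD(2)[OF wf] proves_Forall_elim[of "\<phi>" T v] assms unfolding \<beta>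
    by (auto intro: entails.MP entails.Thm)
  ultimately have "entails T {} (\<alpha> \<^bold>\<and> \<beta> \<^bold>\<longrightarrow> \<psi>)"
    using wf by (intro deduction) (auto intro: entails.MP)
  then have "T \<turnstile> \<alpha> \<^bold>\<and> \<beta> \<^bold>\<longrightarrow> (\<^bold>\<forall>v. \<psi>)"
    by (intro proves.Gen entails_empty) (auto simp: \<alpha> \<beta> And_def Neg_def)
  then have "entails T {\<beta>, \<alpha>} (\<^bold>\<forall>v. \<psi>)"
    using entails_AndI[OF wf, of T] by (auto intro: entails.MP entails.Thm simp: insert_commute)
  then show ?thesis using wf deduction[of T \<beta> "{\<alpha>}"] deduction[of T \<alpha> "{}"] entails_empty
    unfolding \<alpha> \<beta> by blast
qed

text \<open>Generalisation becomes admissible under hypotheses that do not mention the variable.\<close>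

lemma entails_Forall:
  assumes "entails T \<Gamma> \<phi>" and "\<forall>\<gamma>\<in>\<Gamma>. v \<notin> fv \<gamma>"
  shows "entails T \<Gamma> (\<^bold>\<forall>v. \<phi>)"
  using assms(1)
proof (induction rule: entails.induct)
  case (Thm \<phi>)
  then show ?case by (auto intro: entails.Thm proves_Forall)
next
  case (Hyp \<phi>)
  then show ?case using assms(2) by (meson entails.simps proves.Gen proves_refl)
next
  case (MP \<phi> \<psi>)
  then have "wff [] \<phi>" "wff [] \<psi>" using entails_wff by fastforce+
  then show ?case using MP proves_Forall_Imp entails.MP entails.Thm by meson
qed

text \<open>Derivations are finite, so the union of a chain of consistent sets is consistent.\<close>

lemma entails_finite: "entails T \<Gamma> \<phi> \<Longrightarrow> \<exists>\<Delta>. finite \<Delta> \<and> \<Delta> \<subseteq> \<Gamma> \<and> entails T \<Delta> \<phi>"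
proof (induction rule: entails.induct)
  case (Thm \<phi>)
  then show ?case by (meson entails.Thm empty_subsetI finite.emptyI)
next
  case (Hyp \<phi>)
  then show ?case by (intro exI[of _ "{\<phi>}"]) (auto intro: entails.Hyp)
next
  case (MP \<phi> \<psi>)
  then obtain \<Delta> \<Delta>' where "finite \<Delta>" "\<Delta> \<subseteq> \<Gamma>" "entails T \<Delta> (\<phi> \<^bold>\<longrightarrow> \<psi>)"
    "finite \<Delta>'" "\<Delta>' \<subseteq> \<Gamma>" "entails T \<Delta>' \<phi>" by blast
  then show ?case
    by (intro exI[of _ "\<Delta> \<union> \<Delta>'"]) (auto intro: entails.MP entails_mono)
qed

section \<open>Henkin sets\<close>

instance ty :: countable by countable_datatype
instance tm :: countable by countable_datatype
instance fm :: countable by countable_datatype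

definition consistent :: "fm set \<Rightarrow> fm set \<Rightarrow> bool" where
  "consistent T \<Gamma> \<longleftrightarrow> \<not> entails T \<Gamma> \<^bold>\<bottom>"

text \<open>
  The witnesses of the Henkin construction are named variables, of which every type has infinitely many.
\<close>

lemma ex_fresh:
  assumes "finite X"
  shows "\<exists>v :: var. snd v = \<tau> \<and> v \<notin> X"
proof -
  have "infinite (UNIV :: string set)" by (simp add: infinite_UNIV_listI)
  then have "infinite (range (\<lambda>s::string. (s, \<tau>)))" by (simp add: finite_image_iff inj_on_def)
  then have "\<not> range (\<lambda>s::string. (s, \<tau>)) \<subseteq> X" using assms finite_subset by blast
  then show ?thesis by auto
qed

text \<open>
  One stage of the Lindenbaum--Henkin construction: \<open>\<psi>\<close> is decided, and if it is an accepted negated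
  universal statement, a counterexample is added with it. The counterexample is a variable \<open>v\<close> that
  is fresh for the finite set at hand. If adding it were inconsistent, the instance at \<open>v\<close> would be
  derivable, hence so would the universal statement by generalisation.
\<close>

lemma henkin_step:
  assumes fin: "finite \<Gamma>" and con: "consistent T \<Gamma>" and wf: "wff [] \<psi>"
  shows "\<exists>\<Gamma>'. finite \<Gamma>' \<and> consistent T \<Gamma>' \<and> \<Gamma> \<subseteq> \<Gamma>' \<and>
    (\<psi> \<in> \<Gamma>' \<or> entails T \<Gamma>' (\<^bold>\<not> \<psi>)) \<and>
    (\<psi> \<in> \<Gamma>' \<longrightarrow> (\<forall>\<tau> \<theta>. \<psi> = \<^bold>\<not> All \<tau> \<theta> \<longrightarrow>
       (\<exists>t. tyof [] t = Some \<tau> \<and> \<^bold>\<not> inst_fm t 0 \<theta> \<in> \<Gamma>')))"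
proof (cases "consistent T (insert \<psi> \<Gamma>)")
  case False
  then have ent: "entails T \<Gamma> (\<^bold>\<not> \<psi>)"
    using deduction[of T \<psi> \<Gamma>] wf by (simp add: consistent_def Neg_def)
  moreover have "\<psi> \<notin> \<Gamma>"
    using ent con wf by (metis Neg_def consistent_def entails.Hyp entails.MP)
  ultimately show ?thesis using fin con by (intro exI[of _ \<Gamma>]) auto
next
  case True
  show ?thesis
  proof (cases "\<exists>\<tau> \<theta>. \<psi> = \<^bold>\<not> All \<tau> \<theta>")
    case False
    then show ?thesis using True fin by (intro exI[of _ "insert \<psi> \<Gamma>"]) auto
  next
    case ex: True
    then obtain \<tau> \<theta> where \<psi>: "\<psi> = \<^bold>\<not> All \<tau> \<theta>" by blast
    have "finite (\<Union> (fv ` insert \<psi> \<Gamma>))" using fin by simp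
    then obtain v where v: "snd v = \<tau>" "v \<notin> \<Union> (fv ` insert \<psi> \<Gamma>)" using ex_fresh by blast
    define \<Delta> where "\<Delta> = insert (\<^bold>\<not> inst_fm (V v) 0 \<theta>) (insert \<psi> \<Gamma>)"
    have v\<theta>: "v \<notin> fv \<theta>" using v by (simp add: \<psi> Neg_def)
    have "consistent T \<Delta>"
      unfolding consistent_def
    proof
      assume "entails T \<Delta> \<^bold>\<bottom>"
      then have "entails T (insert \<psi> \<Gamma>) (inst_fm (V v) 0 \<theta>)"
        unfolding \<Delta>_def using wf wff_inst[of "V v" \<tau> "[]" \<theta>] v(1)
        by (intro entails_dneg[of T "inst_fm (V v) 0 \<theta>"]) (simp_all add: \<psi>)
      then have "entails T (insert \<psi> \<Gamma>) (\<^bold>\<forall>v. inst_fm (V v) 0 \<theta>)"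
        using v by (intro entails_Forall) auto
      then have "entails T (insert \<psi> \<Gamma>) (All \<tau> \<theta>)"
        using v by (simp add: Forall_def abs_inst v\<theta>)
      moreover have "entails T (insert \<psi> \<Gamma>) \<psi>" using wf by (auto intro: entails.Hyp)
      ultimately show False using True entails.MP[of T _ "All \<tau> \<theta>" "\<^bold>\<bottom>"]
        unfolding \<psi> Neg_def consistent_def by blast
    qed
    then show ?thesis using fin v
      by (intro exI[of _ \<Delta>]) (auto simp: \<Delta>_def \<psi> Neg_def intro!: exI[of _ "V v"])
  qed
qed

text \<open>
  A set with the closure properties of truth, where the terms without loose indices, which may contain
  named variables, play the role of the individuals.
\<close>

locale henkin_set =
  fixes T H :: "fm set"
  assumes theorem_mem: "T \<turnstile> \<phi> \<Longrightarrow> \<phi> \<in> H"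
    and falsum: "\<^bold>\<bottom> \<notin> H"
    and imp: "wff [] \<phi> \<Longrightarrow> wff [] \<psi> \<Longrightarrow> (\<phi> \<^bold>\<longrightarrow> \<psi>) \<in> H \<longleftrightarrow> (\<phi> \<in> H \<longrightarrow> \<psi> \<in> H)"
    and all: "wff [\<tau>] \<phi> \<Longrightarrow> All \<tau> \<phi> \<in> H \<longleftrightarrow> (\<forall>t. tyof [] t = Some \<tau> \<longrightarrow> inst_fm t 0 \<phi> \<in> H)"

text \<open>
  The stages run through an enumeration of all formulas. Every stage is finite, which leaves fresh
  variables for the next one.
\<close>

lemma ex_henkin_set:
  assumes wf: "wff [] \<phi>" and np: "\<not> (T \<turnstile> \<phi>)"
  shows "\<exists>H. henkin_set T H \<and> \<phi> \<notin> H"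
proof -
  define en :: "nat \<Rightarrow> fm" where "en = from_nat"
  have con0: "consistent T {\<^bold>\<not> \<phi>}"
    unfolding consistent_def using entails_dneg[of T \<phi> "{}"] entails_empty wf np by blast
  let ?P = "\<lambda>n \<Gamma>. finite \<Gamma> \<and> consistent T \<Gamma> \<and> \<^bold>\<not> \<phi> \<in> \<Gamma>"
  let ?Q = "\<lambda>n \<Gamma> \<Gamma>'. \<Gamma> \<subseteq> \<Gamma>' \<and> (wff [] (en n) \<longrightarrow>
    (en n \<in> \<Gamma>' \<or> entails T \<Gamma>' (\<^bold>\<not> en n)) \<and>
    (en n \<in> \<Gamma>' \<longrightarrow> (\<forall>\<tau> \<theta>. en n = \<^bold>\<not> All \<tau> \<theta> \<longrightarrow>
       (\<exists>t. tyof [] t = Some \<tau> \<and> \<^bold>\<not> inst_fm t 0 \<theta> \<in> \<Gamma>'))))"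
  have "\<exists>\<Gamma>. \<forall>n. ?P n (\<Gamma> n) \<and> ?Q n (\<Gamma> n) (\<Gamma> (Suc n))"
  proof (rule dependent_nat_choice)
    show "\<exists>\<Gamma>. ?P 0 \<Gamma>" using con0 by (intro exI[of _ "{\<^bold>\<not> \<phi>}"]) auto
  next
    fix \<Gamma> n assume P: "?P n \<Gamma>"
    show "\<exists>\<Gamma>'. ?P (Suc n) \<Gamma>' \<and> ?Q n \<Gamma> \<Gamma>'"
    proof (cases "wff [] (en n)")
      case True
      then show ?thesis using henkin_step[of \<Gamma> T "en n"] P by (metis subsetD)
    next
      case False
      then show ?thesis using P by auto
    qed
  qed
  then obtain \<Gamma> where \<Gamma>: "\<forall>n. ?P n (\<Gamma> n) \<and> ?Q n (\<Gamma> n) (\<Gamma> (Suc n))" ..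
  then have P: "?P n (\<Gamma> n)" for n by (rule allE) (rule conjunct1)
  have Q: "?Q n (\<Gamma> n) (\<Gamma> (Suc n))" for n using \<Gamma> by (rule allE) (rule conjunct2)
  define H where "H = {\<psi>. wff [] \<psi> \<and> (\<exists>n. \<psi> \<in> \<Gamma> n)}"
  have inc: "\<Gamma> m \<subseteq> \<Gamma> n" if "m \<le> n" for m n
    using that Q by (meson lift_Suc_mono_le)
  have fin: "\<exists>n. \<Delta> \<subseteq> \<Gamma> n" if "finite \<Delta>" "\<Delta> \<subseteq> H" for \<Delta>
    using that
  proof (induction \<Delta>)
    case (insert \<delta> \<Delta>)
    then obtain m n where "\<delta> \<in> \<Gamma> m" "\<Delta> \<subseteq> \<Gamma> n" by (auto simp: H_def)
    then show ?case using inc[of m "max m n"] inc[of n "max m n"]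
      by (intro exI[of _ "max m n"]) auto
  qed simp
  have con: "consistent T H"
    unfolding consistent_def
  proof
    assume "entails T H \<^bold>\<bottom>"
    then obtain \<Delta> where \<Delta>: "finite \<Delta>" "\<Delta> \<subseteq> H" "entails T \<Delta> \<^bold>\<bottom>" by (auto dest: entails_finite)
    then obtain n where "\<Delta> \<subseteq> \<Gamma> n" using fin by blast
    then show False using entails_mono[OF \<Delta>(3)] P[of n] unfolding consistent_def by blast
  qed
  have ent: "entails T H \<psi>" if "entails T (\<Gamma> n) \<psi>" for n \<psi>
    using that
  proof (induction rule: entails.induct)
    case (MP \<phi> \<psi>)
    then show ?case by (blast intro: entails.MP)
  qed (auto intro: entails.Thm entails.Hyp simp: H_def)
  have dec: "\<psi> \<in> H \<or> entails T H (\<^bold>\<not> \<psi>)" if "wff [] \<psi>" for \<psi>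
  proof -
    obtain n where "en n = \<psi>" unfolding en_def by (metis from_nat_to_nat)
    then show ?thesis using Q[of n] that ent unfolding H_def by blast
  qed
  have mem: "\<psi> \<in> H \<longleftrightarrow> entails T H \<psi>" for \<psi>
  proof
    show "entails T H \<psi>" if "\<psi> \<in> H" using that by (auto intro: entails.Hyp simp: H_def)
    show "\<psi> \<in> H" if "entails T H \<psi>"
      using that dec[of \<psi>] entails_wff[OF that] con entails.MP[of T H \<psi> "\<^bold>\<bottom>"]
      by (auto simp: Neg_def consistent_def)
  qed
  have notmem: "\<^bold>\<not> \<psi> \<in> H \<longleftrightarrow> \<psi> \<notin> H" if "wff [] \<psi>" for \<psi>
    using dec[OF that] con mem entails.MP[of T H \<psi> "\<^bold>\<bottom>"] by (auto simp: Neg_def consistent_def)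
  have "henkin_set T H"
  proof
    show "\<psi> \<in> H" if "T \<turnstile> \<psi>" for \<psi> using that mem entails.Thm by blast
    show "\<^bold>\<bottom> \<notin> H" using con mem by (simp add: consistent_def)
  next
    fix \<phi> \<psi> assume wf: "wff [] \<phi>" "wff [] \<psi>"
    show "(\<phi> \<^bold>\<longrightarrow> \<psi>) \<in> H \<longleftrightarrow> (\<phi> \<in> H \<longrightarrow> \<psi> \<in> H)"
    proof
      assume "(\<phi> \<^bold>\<longrightarrow> \<psi>) \<in> H"
      then show "\<phi> \<in> H \<longrightarrow> \<psi> \<in> H" using mem entails.MP by blast
    next
      assume r: "\<phi> \<in> H \<longrightarrow> \<psi> \<in> H"
      have "entails T (insert \<phi> H) \<psi>"
      proof (cases "\<phi> \<in> H")
        case True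
        then show ?thesis using r mem by (auto intro: entails_mono)
      next
        case False
        then have "entails T (insert \<phi> H) (\<phi> \<^bold>\<longrightarrow> \<^bold>\<bottom>)"
          using dec wf by (auto simp: Neg_def intro: entails_mono)
        then show ?thesis using wf
          by (meson entails.Hyp entails.MP entails_falsum insertI1)
      qed
      then show "(\<phi> \<^bold>\<longrightarrow> \<psi>) \<in> H" using deduction wf mem by blast
    qed
  next
    fix \<tau> \<theta> assume wf: "wff [\<tau>] \<theta>"
    show "All \<tau> \<theta> \<in> H \<longleftrightarrow> (\<forall>t. tyof [] t = Some \<tau> \<longrightarrow> inst_fm t 0 \<theta> \<in> H)"
    proof
      assume "All \<tau> \<theta> \<in> H"
      then show "\<forall>t. tyof [] t = Some \<tau> \<longrightarrow> inst_fm t 0 \<theta> \<in> H"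
        using mem wf proves.Inst[of \<tau> \<theta> _ T] entails.MP entails.Thm by (metis wff.simps(4))
    next
      assume inst: "\<forall>t. tyof [] t = Some \<tau> \<longrightarrow> inst_fm t 0 \<theta> \<in> H"
      show "All \<tau> \<theta> \<in> H"
      proof (rule ccontr)
        assume "All \<tau> \<theta> \<notin> H"
        then have neg: "\<^bold>\<not> All \<tau> \<theta> \<in> H" using notmem wf by auto
        obtain n where n: "en n = \<^bold>\<not> All \<tau> \<theta>" unfolding en_def by (metis from_nat_to_nat)
        have "\<not> entails T (\<Gamma> (Suc n)) (\<^bold>\<not> \<^bold>\<not> All \<tau> \<theta>)"
          using ent mem notmem neg wf by (metis wff.simps(4) wff_Neg)
        then have "\<^bold>\<not> All \<tau> \<theta> \<in> \<Gamma> (Suc n)"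
          using Q[of n] wf n by auto
        then obtain t where t: "tyof [] t = Some \<tau>" "\<^bold>\<not> inst_fm t 0 \<theta> \<in> \<Gamma> (Suc n)"
          using Q[of n] n wf by (auto simp: Neg_def)
        then have "wff [] (inst_fm t 0 \<theta>)" using wff_inst[of t \<tau> "[]" \<theta>] wf by simp
        then show False using t inst notmem H_def by auto
      qed
    qed
  qed
  moreover have "\<phi> \<notin> H" using P[of 0] notmem[OF wf] wf by (auto simp: H_def)
  ultimately show ?thesis by blast
qed

section \<open>Extensional frames\<close>

text \<open>
  The symbol \<open>\<doteq>\<close> is going to be interpreted by equality. The interpretation of the constant symbols
  is indexed by terms because \<open>\<K>\<close> and \<open>\<S>\<close> are families over types.
\<close>

record 'a frame =
  dom :: "ty \<Rightarrow> 'a set"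
  ap :: "'a \<Rightarrow> 'a \<Rightarrow> 'a"
  const :: "tm \<Rightarrow> 'a"

text \<open>The list \<open>l\<close> gives the values of the de Bruijn indices.\<close>

fun val :: "'a frame \<Rightarrow> (var \<Rightarrow> 'a) \<Rightarrow> 'a list \<Rightarrow> tm \<Rightarrow> 'a" where
  "val M e l (V v) = e v"
| "val M e l (Bnd i) = l ! i"
| "val M e l (s \<cdot> t) = ap M (val M e l s) (val M e l t)"
| "val M e l c = const M c"

fun sat :: "'a frame \<Rightarrow> (var \<Rightarrow> 'a) \<Rightarrow> 'a list \<Rightarrow> fm \<Rightarrow> bool" where
  "sat M e l (s \<doteq> t) \<longleftrightarrow> val M e l s = val M e l t"
| "sat M e l \<^bold>\<bottom> \<longleftrightarrow> False"
| "sat M e l (\<phi> \<^bold>\<longrightarrow> \<psi>) \<longleftrightarrow> (sat M e l \<phi> \<longrightarrow> sat M e l \<psi>)"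
| "sat M e l (All \<tau> \<phi>) \<longleftrightarrow> (\<forall>a \<in> dom M \<tau>. sat M e (a # l) \<phi>)"

definition assignment :: "'a frame \<Rightarrow> (var \<Rightarrow> 'a) \<Rightarrow> bool" where
  "assignment M e \<longleftrightarrow> (\<forall>v. e v \<in> dom M (snd v))"

text \<open>
  Abstraction and instantiation act on the outermost index, which is the last entry of the list; the
  entries before it belong to quantifiers that have been entered since.
\<close>

lemma val_abs:
  "tyof \<Gamma> t = Some \<tau> \<Longrightarrow> length \<Gamma> = length l \<Longrightarrow>
     val M e (l @ [a]) (abs_tm v (length l) t) = val M (e(v := a)) l t"
  by (induction t arbitrary: \<tau>)
    (auto simp: nth_append split: if_splits)

lemma sat_abs:
  "wff \<Gamma> \<phi> \<Longrightarrow> length \<Gamma> = length l \<Longrightarrow>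
     sat M e (l @ [a]) (abs_fm v (length l) \<phi>) = sat M (e(v := a)) l \<phi>"
proof (induction \<phi> arbitrary: \<Gamma> l)
  case (All \<tau> \<phi>)
  then show ?case using All.IH[of "\<tau> # \<Gamma>" "_ # l"] by simp
qed (auto simp: val_abs)

lemma val_extend: "tyof [] u = Some \<tau> \<Longrightarrow> val M e l u = val M e [] u"
  by (induction u arbitrary: \<tau>) auto

lemma val_inst:
  assumes "tyof [] u = Some \<tau>"
  shows "tyof (\<Gamma> @ [\<tau>]) t = Some \<sigma> \<Longrightarrow> length \<Gamma> = length l \<Longrightarrow>
     val M e l (inst_tm u (length l) t) = val M e (l @ [val M e [] u]) t"
  by (induction t arbitrary: \<sigma>)
    (auto simp: nth_append val_extend[OF assms, of M e l] split: if_splits)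

lemma sat_inst:
  assumes "tyof [] u = Some \<tau>"
  shows "wff (\<Gamma> @ [\<tau>]) \<phi> \<Longrightarrow> length \<Gamma> = length l \<Longrightarrow>
     sat M e l (inst_fm u (length l) \<phi>) = sat M e (l @ [val M e [] u]) \<phi>"
proof (induction \<phi> arbitrary: \<Gamma> l)
  case (All \<sigma> \<phi>)
  then show ?case using All.IH[of "\<sigma> # \<Gamma>" "_ # l"] by simp
qed (auto simp: val_inst[OF assms])

lemma sat_Forall: "wff [] \<phi> \<Longrightarrow> sat M e [] (\<^bold>\<forall>v. \<phi>) \<longleftrightarrow> (\<forall>a \<in> dom M (snd v). sat M (e(v := a)) [] \<phi>)"
  using sat_abs[of "[]" \<phi> "[]" M e] by (simp add: Forall_def)

lemma sat_Neg [simp]: "sat M e l (\<^bold>\<not> \<phi>) \<longleftrightarrow> \<not> sat M e l \<phi>"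
  by (simp add: Neg_def)

lemma sat_And [simp]: "sat M e l (\<phi> \<^bold>\<and> \<psi>) \<longleftrightarrow> sat M e l \<phi> \<and> sat M e l \<psi>"
  by (simp add: And_def)

lemma sat_Exists: "wff [] \<phi> \<Longrightarrow> sat M e [] (\<^bold>\<exists>v. \<phi>) \<longleftrightarrow> (\<exists>a \<in> dom M (snd v). sat M (e(v := a)) [] \<phi>)"
  by (simp add: Exists_def sat_Forall)

lemma sat_subst:
  "wff [] \<phi> \<Longrightarrow> tyof [] t = Some (snd v) \<Longrightarrow> sat M e [] (\<phi>[v \<^bold>:= t]) = sat M (e(v := val M e [] t)) [] \<phi>"
  using sat_inst[of t "snd v" "[]" "abs_fm v 0 \<phi>" "[]" M e] sat_abs[of "[]" \<phi> "[]" M e] wff_abs[of "[]" \<phi> v]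
  by (simp add: subst_def)

lemma val_cong: "(\<And>v. v \<in> fv_tm t \<Longrightarrow> e v = e' v) \<Longrightarrow> val M e l t = val M e' l t"
  by (induction t) auto

lemma sat_cong: "(\<And>v. v \<in> fv \<phi> \<Longrightarrow> e v = e' v) \<Longrightarrow> sat M e l \<phi> = sat M e' l \<phi>"
  by (induction \<phi> arbitrary: l) (auto simp: val_cong[of _ e e'])

locale extensional_frame =
  fixes M :: "'a frame"
  assumes const_dom: "tyof [] c = Some \<tau> \<Longrightarrow> (\<forall>v. c \<noteq> V v) \<Longrightarrow> (\<forall>s t. c \<noteq> s \<cdot> t) \<Longrightarrow> const M c \<in> dom M \<tau>"
    and ap_dom: "f \<in> dom M (\<sigma> \<leadsto> \<tau>) \<Longrightarrow> x \<in> dom M \<sigma> \<Longrightarrow> ap M f x \<in> dom M \<tau>"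
    and extensional: "f \<in> dom M (\<sigma> \<leadsto> \<tau>) \<Longrightarrow> g \<in> dom M (\<sigma> \<leadsto> \<tau>) \<Longrightarrow>
      (\<And>x. x \<in> dom M \<sigma> \<Longrightarrow> ap M f x = ap M g x) \<Longrightarrow> f = g"

locale model = extensional_frame M for M :: "'a frame" +
  fixes T :: "fm set"
  assumes valid: "\<phi> \<in> T \<Longrightarrow> wff [] \<phi> \<Longrightarrow> assignment M e \<Longrightarrow> sat M e [] \<phi>"

section \<open>Completeness\<close>

lemma lift_closed: "tyof [] t = Some \<tau> \<Longrightarrow> lift t = t"
  by (induction t arbitrary: \<tau>) auto

lemma abs_lift: "abs_tm v (Suc k) (lift t) = lift (abs_tm v k t)"
  by (induction t) auto

lemma inst_lift: "lift u = u \<Longrightarrow> inst_tm u (Suc k) (lift t) = lift (inst_tm u k t)"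
  by (induction t) auto

lemma abs_eq_ty: "abs_fm v k (eq_ty \<tau> s t) = eq_ty \<tau> (abs_tm v k s) (abs_tm v k t)"
  by (induction \<tau> arbitrary: k s t) (auto simp: abs_lift)

lemma inst_eq_ty:
  "lift u = u \<Longrightarrow> inst_fm u k (eq_ty \<tau> s t) = eq_ty \<tau> (inst_tm u k s) (inst_tm u k t)"
  by (induction \<tau> arbitrary: k s t) (auto simp: inst_lift)

lemma tyof_lift: "tyof \<Gamma> t = Some \<tau> \<Longrightarrow> tyof (\<sigma> # \<Gamma>) (lift t) = Some \<tau>"
  by (induction t arbitrary: \<tau>) (auto split: if_splits)

lemma wff_eq_ty: "tyof \<Gamma> s = Some \<tau> \<Longrightarrow> tyof \<Gamma> t = Some \<tau> \<Longrightarrow> wff \<Gamma> (eq_ty \<tau> s t)"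
  by (induction \<tau> arbitrary: \<Gamma> s t) (auto simp: tyof_lift)

fun connectives :: "fm \<Rightarrow> nat" where
  "connectives (s \<doteq> t) = 0"
| "connectives \<^bold>\<bottom> = 0"
| "connectives (\<phi> \<^bold>\<longrightarrow> \<psi>) = Suc (connectives \<phi> + connectives \<psi>)"
| "connectives (All \<tau> \<phi>) = Suc (connectives \<phi>)"

lemma connectives_inst [simp]: "connectives (inst_fm u k \<phi>) = connectives \<phi>"
  by (induction \<phi> arbitrary: k) auto

text \<open>
  The axioms of equality and extensionality in \<open>E_PRA\<close> make the equations that belong to
  the set, taken at all types, a congruence, so that the terms modulo this congruence
  form an extensional frame.
\<close>

locale arithmetic_henkin_set = henkin_set +
  assumes E_PRA: "E_PRA \<subseteq> T"
begin

lemma axiom_mem: "\<phi> \<in> E_PRA \<Longrightarrow> wff [] \<phi> \<Longrightarrow> T \<turnstile> \<phi>"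
  using E_PRA by (blast intro: proves.Ax)

lemma All_elim: "All \<tau> \<phi> \<in> H \<Longrightarrow> wff [\<tau>] \<phi> \<Longrightarrow> tyof [] t = Some \<tau> \<Longrightarrow> inst_fm t 0 \<phi> \<in> H"
  using all by blast

lemma eq_refl: "tyof [] s = Some Nat \<Longrightarrow> (s \<doteq> s) \<in> H"
  using theorem_mem[OF proves_Forall[OF axiom_mem[OF E_PRA.eq_refl], of "(''x'', Nat)"]]
  by (auto simp: Forall_def all)

lemma eq_euclid:
  assumes "tyof [] s = Some Nat" "tyof [] t = Some Nat" "tyof [] u = Some Nat"
    "(s \<doteq> t) \<in> H" "(s \<doteq> u) \<in> H"
  shows "(t \<doteq> u) \<in> H"
proof -
  have "(\<^bold>\<forall>(''x'', Nat). \<^bold>\<forall>(''y'', Nat). \<^bold>\<forall>(''z'', Nat). V (''x'', Nat) \<doteq> V (''y'', Nat) \<^bold>\<longrightarrow>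
      V (''x'', Nat) \<doteq> V (''z'', Nat) \<^bold>\<longrightarrow> V (''y'', Nat) \<doteq> V (''z'', Nat)) \<in> H"
    by (intro theorem_mem proves_Forall axiom_mem E_PRA.eq_euclid) simp
  then have "All Nat (All Nat (All Nat
      (Bnd 2 \<doteq> Bnd 1 \<^bold>\<longrightarrow> Bnd 2 \<doteq> Bnd 0 \<^bold>\<longrightarrow> Bnd 1 \<doteq> Bnd 0))) \<in> H"
    by (simp add: Forall_def numeral_2_eq_2)
  from All_elim[OF this _ assms(1)]
  have "All Nat (All Nat (s \<doteq> Bnd 1 \<^bold>\<longrightarrow> s \<doteq> Bnd 0 \<^bold>\<longrightarrow> Bnd 1 \<doteq> Bnd 0)) \<in> H"
    by (simp add: numeral_2_eq_2)
  from All_elim[OF this _ assms(2)]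
  have "All Nat (s \<doteq> t \<^bold>\<longrightarrow> s \<doteq> Bnd 0 \<^bold>\<longrightarrow> t \<doteq> Bnd 0) \<in> H"
    using assms(1) by (simp add: assms(1-2)[THEN inst_tm_closed] assms(1-2)[THEN tyof_closed])
  from All_elim[OF this _ assms(3)]
  have "(s \<doteq> t \<^bold>\<longrightarrow> s \<doteq> u \<^bold>\<longrightarrow> t \<doteq> u) \<in> H"
    using assms(1,2) by (simp add: assms(1-2)[THEN inst_tm_closed] assms(1-2)[THEN tyof_closed])
  then show ?thesis using assms by (simp add: imp)
qed

lemma eq_ext:
  assumes s: "tyof [] s = Some \<sigma>" "tyof [] t = Some \<sigma>" "tyof [] u = Some (\<sigma> \<leadsto> \<tau>)"
    and eq: "eq_ty \<sigma> s t \<in> H"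
  shows "eq_ty \<tau> (u \<cdot> s) (u \<cdot> t) \<in> H"
proof -
  let ?x = "V (''x'', \<sigma>)" and ?y = "V (''y'', \<sigma>)" and ?z = "V (''z'', \<sigma> \<leadsto> \<tau>)"
  have "(\<^bold>\<forall>(''x'', \<sigma>). \<^bold>\<forall>(''y'', \<sigma>). \<^bold>\<forall>(''z'', \<sigma> \<leadsto> \<tau>).
      eq_ty \<sigma> ?x ?y \<^bold>\<longrightarrow> eq_ty \<tau> (?z \<cdot> ?x) (?z \<cdot> ?y)) \<in> H"
    by (intro theorem_mem proves_Forall axiom_mem E_PRA.extensionality) (simp add: wff_eq_ty)
  then have "All \<sigma> (All \<sigma> (All (\<sigma> \<leadsto> \<tau>)
      (eq_ty \<sigma> (Bnd 2) (Bnd 1) \<^bold>\<longrightarrow> eq_ty \<tau> (Bnd 0 \<cdot> Bnd 2) (Bnd 0 \<cdot> Bnd 1)))) \<in> H"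
    by (simp add: Forall_def abs_eq_ty numeral_2_eq_2)
  from All_elim[OF this _ s(1)]
  have "All \<sigma> (All (\<sigma> \<leadsto> \<tau>)
      (eq_ty \<sigma> s (Bnd 1) \<^bold>\<longrightarrow> eq_ty \<tau> (Bnd 0 \<cdot> s) (Bnd 0 \<cdot> Bnd 1))) \<in> H"
    by (simp add: inst_eq_ty wff_eq_ty s[THEN lift_closed] s[THEN tyof_closed] numeral_2_eq_2)
  from All_elim[OF this _ s(2)]
  have "All (\<sigma> \<leadsto> \<tau>) (eq_ty \<sigma> s t \<^bold>\<longrightarrow> eq_ty \<tau> (Bnd 0 \<cdot> s) (Bnd 0 \<cdot> t)) \<in> H"
    by (simp add: inst_eq_ty wff_eq_ty s[THEN lift_closed] s[THEN tyof_closed] s[THEN inst_tm_closed] s[THEN tyof_closed])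
  from All_elim[OF this _ s(3)]
  have "(eq_ty \<sigma> s t \<^bold>\<longrightarrow> eq_ty \<tau> (u \<cdot> s) (u \<cdot> t)) \<in> H"
    by (simp add: inst_eq_ty wff_eq_ty s[THEN lift_closed] s[THEN tyof_closed] s[THEN inst_tm_closed] s[THEN tyof_closed])
  then show ?thesis using eq s by (simp add: imp wff_eq_ty)
qed

lemma eq_Fun:
  assumes "tyof [] s = Some (\<sigma> \<leadsto> \<tau>)" "tyof [] t = Some (\<sigma> \<leadsto> \<tau>)"
  shows "eq_ty (\<sigma> \<leadsto> \<tau>) s t \<in> H \<longleftrightarrow> (\<forall>u. tyof [] u = Some \<sigma> \<longrightarrow> eq_ty \<tau> (s \<cdot> u) (t \<cdot> u) \<in> H)"
  using assms
  by (auto simp: all wff_eq_ty lift_closed assms[THEN tyof_closed] inst_eq_ty assms[THEN inst_tm_closed])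

definition equivalent :: "tm \<Rightarrow> tm \<Rightarrow> bool" where
  "equivalent s t \<longleftrightarrow> (\<exists>\<tau>. tyof [] s = Some \<tau> \<and> tyof [] t = Some \<tau> \<and> eq_ty \<tau> s t \<in> H)"

lemma equivalent_refl: "tyof [] s = Some \<tau> \<Longrightarrow> equivalent s s"
proof -
  have "tyof [] s = Some \<tau> \<Longrightarrow> eq_ty \<tau> s s \<in> H" by (induction \<tau> arbitrary: s) (auto simp: eq_refl eq_Fun simp del: eq_ty.simps(2))
  then show "tyof [] s = Some \<tau> \<Longrightarrow> equivalent s s" by (simp add: equivalent_def)
qed

lemma equivalent_euclid: "equivalent s t \<Longrightarrow> equivalent s u \<Longrightarrow> equivalent t u"
proof -
  have "tyof [] s = Some \<tau> \<Longrightarrow> tyof [] t = Some \<tau> \<Longrightarrow> tyof [] u = Some \<tau> \<Longrightarrow>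
    eq_ty \<tau> s t \<in> H \<Longrightarrow> eq_ty \<tau> s u \<in> H \<Longrightarrow> eq_ty \<tau> t u \<in> H" for \<tau>
  proof (induction \<tau> arbitrary: s t u)
    case Nat
    then show ?case using eq_euclid[of s t u] by simp
  next
    case (Fun \<sigma> \<tau>)
    have "eq_ty \<tau> (t \<cdot> w) (u \<cdot> w) \<in> H" if "tyof [] w = Some \<sigma>" for w
      using Fun.IH(2)[of "s \<cdot> w" "t \<cdot> w" "u \<cdot> w"] Fun.prems that
      by (simp add: eq_Fun del: eq_ty.simps(2))
    then show ?case using Fun.prems by (simp add: eq_Fun del: eq_ty.simps(2))
  qed
  then show "equivalent s t \<Longrightarrow> equivalent s u \<Longrightarrow> equivalent t u"
    by (auto simp: equivalent_def)
qed

lemma equivalent_sym: "equivalent s t \<Longrightarrow> equivalent t s"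
  by (meson equivalent_def equivalent_euclid equivalent_refl)

lemma equivalent_App:
  assumes "tyof [] (s \<cdot> t) = Some \<tau>" "equivalent s s'" "equivalent t t'"
  shows "equivalent (s \<cdot> t) (s' \<cdot> t')"
proof -
  obtain \<sigma> where ty: "tyof [] s = Some (\<sigma> \<leadsto> \<tau>)" "tyof [] t = Some \<sigma>" using assms(1) by auto
  with assms have ty': "tyof [] s' = Some (\<sigma> \<leadsto> \<tau>)" "tyof [] t' = Some \<sigma>"
    by (auto simp: equivalent_def)
  have "equivalent (s \<cdot> t) (s' \<cdot> t)"
    using assms(2) ty ty' by (auto simp: equivalent_def eq_Fun simp del: eq_ty.simps(2))
  moreover have "equivalent (s' \<cdot> t) (s' \<cdot> t')"
    using assms(3) ty ty' eq_ext by (auto simp: equivalent_def)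
  ultimately show ?thesis using equivalent_sym equivalent_euclid by blast
qed

text \<open>Chosen representatives serve as the elements of the quotient.\<close>

definition rep :: "tm \<Rightarrow> tm" where
  "rep t = (SOME s. equivalent t s)"

lemma equivalent_rep: "tyof [] t = Some \<tau> \<Longrightarrow> equivalent t (rep t)"
  unfolding rep_def by (rule someI) (rule equivalent_refl)

lemma rep_eqI: "equivalent s t \<Longrightarrow> rep s = rep t"
proof -
  assume "equivalent s t"
  then have "equivalent s u \<longleftrightarrow> equivalent t u" for u
    using equivalent_sym equivalent_euclid by blast
  then show "rep s = rep t" by (simp add: rep_def)
qed

lemma rep_eq_iff: "tyof [] s = Some \<tau> \<Longrightarrow> tyof [] t = Some \<tau> \<Longrightarrow> rep s = rep t \<longleftrightarrow> eq_ty \<tau> s t \<in> H"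
proof
  assume ty: "tyof [] s = Some \<tau>" "tyof [] t = Some \<tau>"
  show "eq_ty \<tau> s t \<in> H" if "rep s = rep t"
    using equivalent_rep[OF ty(1)] equivalent_rep[OF ty(2)] that ty equivalent_sym equivalent_euclid
    by (metis equivalent_def option.inject)
  assume "eq_ty \<tau> s t \<in> H"
  then show "rep s = rep t" using ty by (auto simp: equivalent_def intro: rep_eqI)
qed

lemma tyof_rep: "tyof [] t = Some \<tau> \<Longrightarrow> tyof [] (rep t) = Some \<tau>"
  using equivalent_rep by (fastforce simp: equivalent_def)

lemma rep_App: "tyof [] (s \<cdot> t) = Some \<tau> \<Longrightarrow> rep (rep s \<cdot> rep t) = rep (s \<cdot> t)"
  by (metis equivalent_App equivalent_rep equivalent_sym rep_eqI tyof_App_eq_Some)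

definition term_frame :: "tm frame" where
  "term_frame = \<lparr>dom = \<lambda>\<tau>. {rep t | t. tyof [] t = Some \<tau>}, ap = \<lambda>s t. rep (s \<cdot> t), const = rep\<rparr>"

lemma val_term_frame:
  "tyof [] t = Some \<tau> \<Longrightarrow> val term_frame (\<lambda>v. rep (V v)) [] t = rep t"
proof (induction t arbitrary: \<tau>)
  case (App s t)
  then show ?case using rep_App[of s t \<tau>] by (auto simp: term_frame_def)
qed (auto simp: term_frame_def)

text \<open>
  The truth lemma, by induction on the number of connectives and quantifiers: instantiation does not
  change this number, and the individuals of the frame are exactly the values of terms.
\<close>

lemma sat_term_frame:
  "wff [] \<phi> \<Longrightarrow> sat term_frame (\<lambda>v. rep (V v)) [] \<phi> \<longleftrightarrow> \<phi> \<in> H"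
proof (induction "connectives \<phi>" arbitrary: \<phi> rule: less_induct)
  case less
  show ?case
  proof (cases \<phi>)
    case (Eq s t)
    then show ?thesis using less.prems by (simp add: val_term_frame rep_eq_iff)
  next
    case Falsum
    then show ?thesis by (simp add: falsum)
  next
    case (Imp \<phi>1 \<phi>2)
    then show ?thesis using less by (simp add: imp)
  next
    case (All \<tau> \<theta>)
    have "sat term_frame (\<lambda>v. rep (V v)) [rep t] \<theta> \<longleftrightarrow> inst_fm t 0 \<theta> \<in> H"
      if "tyof [] t = Some \<tau>" for t
      using sat_inst[of t \<tau> "[]" \<theta> "[]" term_frame "\<lambda>v. rep (V v)"]
        less.hyps[of "inst_fm t 0 \<theta>"] wff_inst[of t \<tau> "[]" \<theta>] that less.prems All
      by (simp add: val_term_frame)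
    then show ?thesis using All less.prems by (auto simp: all term_frame_def)
  qed
qed

lemma assignment_term_frame: "assignment term_frame (\<lambda>v. rep (V v))"
  by (auto simp: assignment_def term_frame_def intro!: exI[of _ "V _"])

text \<open>
  The truth lemma speaks about the canonical assignment only. Other assignments are reached by
  generalising a theorem over its free variables and instantiating the quantifiers with the values
  desired.
\<close>

lemma theorem_valid:
  assumes "T \<turnstile> \<phi>" "assignment term_frame e"
  shows "sat term_frame e [] \<phi>"
proof -
  let ?canon = "\<lambda>v. rep (V v)"
  have wf: "wff [] (foldr Forall vs \<psi>)" if "wff [] \<psi>" for vs \<psi>
    using that by (induction vs) (auto intro: wff_Forall)
  have closure: "T \<turnstile> foldr Forall vs \<phi>" for vs
    by (induction vs) (auto intro: proves_Forall assms)
  have inst: "sat term_frame e' [] \<phi>"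
    if "sat term_frame e0 [] (foldr Forall vs \<phi>)" "assignment term_frame e'"
      "\<And>v. v \<notin> set vs \<Longrightarrow> e' v = e0 v" for e0 e' vs
    using that
  proof (induction vs arbitrary: e0)
    case Nil
    then show ?case using sat_cong[of \<phi> e' e0] by simp
  next
    case (Cons v vs)
    have "e' v \<in> dom term_frame (snd v)" using Cons.prems(2) unfolding assignment_def by blast
    then have "sat term_frame (e0(v := e' v)) [] (foldr Forall vs \<phi>)"
      using Cons.prems wf[OF proves_wff[OF assms(1)]] by (simp add: sat_Forall)
    then show ?case by (rule Cons.IH) (use Cons.prems(2,3) in simp_all)
  qed
  obtain vs where vs: "set vs = fv \<phi>" using finite_list[OF finite_fv] by blast
  let ?e = "\<lambda>v. if v \<in> fv \<phi> then e v else ?canon v"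
  have "sat term_frame ?canon [] (foldr Forall vs \<phi>)"
    using sat_term_frame[OF proves_wff[OF closure[of vs]]] theorem_mem[OF closure[of vs]] by simp
  moreover have "assignment term_frame ?e"
    using assms(2) assignment_term_frame by (auto simp: assignment_def)
  ultimately have "sat term_frame ?e [] \<phi>" using vs by (intro inst[of ?canon vs]) auto
  moreover have "sat term_frame ?e [] \<phi> = sat term_frame e [] \<phi>" by (rule sat_cong) simp
  ultimately show ?thesis by simp
qed

lemma model_term_frame: "model term_frame T"
proof
  fix c \<tau> assume "tyof [] c = Some \<tau>" "\<forall>v. c \<noteq> V v" "\<forall>s t. c \<noteq> s \<cdot> t"
  then show "const term_frame c \<in> dom term_frame \<tau>" by (auto simp: term_frame_def)
next
  fix f \<sigma> \<tau> x assume "f \<in> dom term_frame (\<sigma> \<leadsto> \<tau>)" "x \<in> dom term_frame \<sigma>"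
  then obtain s t where "f = rep s" "x = rep t" "tyof [] s = Some (\<sigma> \<leadsto> \<tau>)" "tyof [] t = Some \<sigma>"
    by (auto simp: term_frame_def)
  then show "ap term_frame f x \<in> dom term_frame \<tau>"
    by (auto simp: term_frame_def intro!: exI[of _ "rep s \<cdot> rep t"] tyof_rep)
next
  fix f \<sigma> \<tau> g
  assume f: "f \<in> dom term_frame (\<sigma> \<leadsto> \<tau>)" and g: "g \<in> dom term_frame (\<sigma> \<leadsto> \<tau>)"
    and eq: "\<And>x. x \<in> dom term_frame \<sigma> \<Longrightarrow> ap term_frame f x = ap term_frame g x"
  from f g obtain s t where st: "f = rep s" "g = rep t" "tyof [] s = Some (\<sigma> \<leadsto> \<tau>)"
    "tyof [] t = Some (\<sigma> \<leadsto> \<tau>)" by (auto simp: term_frame_def)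
  have "eq_ty \<tau> (s \<cdot> u) (t \<cdot> u) \<in> H" if u: "tyof [] u = Some \<sigma>" for u
  proof -
    have "rep (rep s \<cdot> rep u) = rep (rep t \<cdot> rep u)"
      using eq[of "rep u"] u st by (auto simp: term_frame_def)
    then have "rep (s \<cdot> u) = rep (t \<cdot> u)"
      using rep_App[of s u \<tau>] rep_App[of t u \<tau>] st u by auto
    then show ?thesis using rep_eq_iff[of "s \<cdot> u" \<tau> "t \<cdot> u"] st u by auto
  qed
  then have "eq_ty (\<sigma> \<leadsto> \<tau>) s t \<in> H" using eq_Fun st by blast
  then show "f = g" using rep_eq_iff st by blast
next
  show "sat term_frame e [] \<phi>" if "\<phi> \<in> T" "wff [] \<phi>" "assignment term_frame e" for \<phi> e
    using that theorem_valid proves.Ax by blast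
qed

end

text \<open>
  A formula that is not provable fails in the term frame of some Henkin set. This turns
  the construction of formal derivations into reasoning about an arbitrary model.
\<close>

theorem completeness:
  assumes "E_PRA \<subseteq> T" "wff [] \<phi>"
    and valid: "\<And>(M :: tm frame) e. model M T \<Longrightarrow> assignment M e \<Longrightarrow> sat M e [] \<phi>"
  shows "T \<turnstile> \<phi>"
proof (rule ccontr)
  assume "\<not> (T \<turnstile> \<phi>)"
  then obtain H where H: "henkin_set T H" "\<phi> \<notin> H" using ex_henkin_set assms(2) by blast
  then interpret arithmetic_henkin_set T H
    using assms(1) by (simp add: arithmetic_henkin_set_def arithmetic_henkin_set_axioms_def)
  show False
    using valid[OF model_term_frame assignment_term_frame] sat_term_frame assms(2) H(2) by blast
qed

text \<open>
  A term \<open>lam v t\<close> is used through its type and its applicative behaviour only; unfolding it into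
  combinators would hide both.
\<close>

declare lam.simps [simp del] lam_closed [simp del]

lemma tyof_lam [simp]: "tyof [] t = Some \<tau> \<Longrightarrow> snd v = \<sigma> \<Longrightarrow> tyof [] (lam v t) = Some (\<sigma> \<leadsto> \<tau>)"
proof (induction t arbitrary: \<tau>)
  case (App s t)
  then obtain \<rho> where "tyof [] s = Some (\<rho> \<leadsto> \<tau>)" "tyof [] t = Some \<rho>" by auto
  moreover have the: "the (tyof [] (s \<cdot> t)) = \<tau>" using App.prems by (simp del: tyof_App_eq_Some)
  ultimately show ?case using App.IH App.prems(2) by (auto simp: lam.simps the)
qed (auto simp: lam.simps)

section \<open>Combinators, recursion and induction in a model\<close>

context extensional_frame
begin

abbreviation N :: "'a set" where "N \<equiv> dom M Nat"
abbreviation app (infixl "\<star>" 80) where "f \<star> x \<equiv> ap M f x"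
definition zero :: 'a where "zero = const M Zero"
definition suc :: "'a \<Rightarrow> 'a" where "suc a = const M Succ \<star> a"

lemma const_Zero [simp]: "const M Zero = zero" and const_Succ [simp]: "const M Succ \<star> a = suc a"
  by (simp_all add: zero_def suc_def)

lemma const_in_dom [simp]:
  "zero \<in> N" "const M Succ \<in> dom M one"
  "const M (\<K> \<rho> \<sigma>) \<in> dom M (\<rho> \<leadsto> \<sigma> \<leadsto> \<rho>)"
  "const M (\<S> \<rho> \<sigma> \<tau>) \<in> dom M ((\<rho> \<leadsto> \<sigma> \<leadsto> \<tau>) \<leadsto> (\<rho> \<leadsto> \<sigma>) \<leadsto> \<rho> \<leadsto> \<tau>)"
  "const M Rec \<in> dom M (Nat \<leadsto> Nat \<leadsto> (Nat \<leadsto> Nat \<leadsto> Nat) \<leadsto> Nat)"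
  using const_dom[of Zero Nat] by (auto intro!: const_dom)

lemma assignmentD: "assignment M e \<Longrightarrow> e v \<in> dom M (snd v)"
  unfolding assignment_def by (rule allE)

lemma val_dom: "assignment M e \<Longrightarrow> tyof [] t = Some \<tau> \<Longrightarrow> val M e [] t \<in> dom M \<tau>"
  by (induction t arbitrary: \<tau>) (auto simp: assignment_def intro: ap_dom)

lemma assignment_upd [simp]: "assignment M e \<Longrightarrow> a \<in> dom M (snd v) \<Longrightarrow> assignment M (e(v := a))"
  by (simp add: assignment_def del: split_paired_All)

lemma dom_nonempty: "dom M \<tau> \<noteq> {}"
proof (induction \<tau>)
  case Nat
  show ?case using const_in_dom(1) by blast
next
  case (Fun \<sigma> \<tau>)
  then obtain a where "a \<in> dom M \<tau>" by blast
  then show ?case using ap_dom[OF const_in_dom(3)] by blast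
qed

text \<open>An arbitrary assignment, which is overwritten at the variables that matter.\<close>

definition base :: "var \<Rightarrow> 'a" where "base v = (SOME a. a \<in> dom M (snd v))"

lemma assignment_base [simp]: "assignment M base"
  using dom_nonempty by (auto simp: assignment_def base_def some_in_eq)

text \<open>The value of a closed term, which depends neither on the assignment nor on the list.\<close>

definition cl :: "tm \<Rightarrow> 'a" where "cl t = val M base [] t"

lemma val_closed: "tyof [] t = Some \<tau> \<Longrightarrow> fv_tm t = {} \<Longrightarrow> val M e l t = cl t"
  using val_extend[of t \<tau> M e l] val_cong[of t e base M "[]"] by (auto simp: cl_def)

lemma val_lift: "val M e (a # l) (lift t) = val M e l t"
  by (induction t) auto

lemma sat_eq_ty:
  "val M e l s \<in> dom M \<tau> \<Longrightarrow> val M e l t \<in> dom M \<tau> \<Longrightarrow>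
     sat M e l (eq_ty \<tau> s t) \<longleftrightarrow> val M e l s = val M e l t"
proof (induction \<tau> arbitrary: l s t)
  case (Fun \<sigma> \<tau>)
  then show ?case using extensional by (auto simp: val_lift ap_dom)
qed simp

end

locale arithmetic_model = model +
  assumes E_PRA: "E_PRA \<subseteq> T"
begin

lemma axiom_sat: "\<phi> \<in> E_PRA \<Longrightarrow> wff [] \<phi> \<Longrightarrow> assignment M e \<Longrightarrow> sat M e [] \<phi>"
  by (rule valid[OF subsetD[OF E_PRA]])

lemma suc_in [simp]: "a \<in> N \<Longrightarrow> suc a \<in> N" unfolding suc_def by (rule ap_dom[OF const_in_dom(2)])

lemma app_in [simp]: "f \<in> dom M one \<Longrightarrow> a \<in> N \<Longrightarrow> f \<star> a \<in> N" by (rule ap_dom)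

lemma app_two_in [simp]: "\<phi> \<in> dom M two \<Longrightarrow> f \<in> dom M one \<Longrightarrow> \<phi> \<star> f \<in> N" by (rule ap_dom)

lemma app_nat2_in [simp]: "c \<in> dom M (Nat \<leadsto> Nat \<leadsto> Nat) \<Longrightarrow> a \<in> N \<Longrightarrow> b \<in> N \<Longrightarrow> c \<star> a \<star> b \<in> N"
  by (meson ap_dom)

lemma suc_neq_zero [simp]: "a \<in> N \<Longrightarrow> suc a \<noteq> zero"
  using axiom_sat[OF E_PRA.succ_nonzero, of "base((''x'', Nat) := a)"] by simp

lemma zero_neq_suc [simp]: "a \<in> N \<Longrightarrow> zero \<noteq> suc a"
  using suc_neq_zero by metis

lemma suc_inj [simp]: "a \<in> N \<Longrightarrow> b \<in> N \<Longrightarrow> suc a = suc b \<longleftrightarrow> a = b"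
  using axiom_sat[OF E_PRA.succ_inj, of "base((''x'', Nat) := a, (''y'', Nat) := b)"] by auto

lemma K_eq [simp]: "a \<in> dom M \<rho> \<Longrightarrow> b \<in> dom M \<sigma> \<Longrightarrow> const M (\<K> \<rho> \<sigma>) \<star> a \<star> b = a"
proof -
  assume ab: "a \<in> dom M \<rho>" "b \<in> dom M \<sigma>"
  let ?e = "base((''x'', \<rho>) := a, (''y'', \<sigma>) := b)"
  have e: "assignment M ?e" using ab by simp
  let ?s = "\<K> \<rho> \<sigma> \<cdot> V (''x'', \<rho>) \<cdot> V (''y'', \<sigma>)"
  let ?t = "V (''x'', \<rho>)"
  have "tyof [] ?s = Some \<rho>" "tyof [] ?t = Some \<rho>" by simp_all
  then have "val M ?e [] ?s = val M ?e [] ?t"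
    using axiom_sat[OF E_PRA.comb_K[of \<rho> \<sigma>] _ e] wff_eq_ty sat_eq_ty val_dom[OF e] by blast
  then show ?thesis by simp
qed

lemma S_eq [simp]:
  assumes "a \<in> dom M (\<rho> \<leadsto> \<sigma> \<leadsto> \<tau>)" "b \<in> dom M (\<rho> \<leadsto> \<sigma>)" "c \<in> dom M \<rho>"
  shows "const M (\<S> \<rho> \<sigma> \<tau>) \<star> a \<star> b \<star> c = a \<star> c \<star> (b \<star> c)"
proof -
  let ?e = "base((''x'', \<rho> \<leadsto> \<sigma> \<leadsto> \<tau>) := a, (''y'', \<rho> \<leadsto> \<sigma>) := b, (''z'', \<rho>) := c)"
  have e: "assignment M ?e" using assms by simp
  let ?s = "\<S> \<rho> \<sigma> \<tau> \<cdot> V (''x'', \<rho> \<leadsto> \<sigma> \<leadsto> \<tau>) \<cdot> V (''y'', \<rho> \<leadsto> \<sigma>) \<cdot> V (''z'', \<rho>)"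
  let ?t = "V (''x'', \<rho> \<leadsto> \<sigma> \<leadsto> \<tau>) \<cdot> V (''z'', \<rho>) \<cdot> (V (''y'', \<rho> \<leadsto> \<sigma>) \<cdot> V (''z'', \<rho>))"
  have "tyof [] ?s = Some \<tau>" "tyof [] ?t = Some \<tau>" by simp_all
  then have "val M ?e [] ?s = val M ?e [] ?t"
    using axiom_sat[OF E_PRA.comb_S[of \<tau> \<rho> \<sigma>] _ e] wff_eq_ty sat_eq_ty val_dom[OF e] by blast
  then show ?thesis by simp
qed

lemma Rec_zero [simp]: "b \<in> N \<Longrightarrow> c \<in> dom M (Nat \<leadsto> Nat \<leadsto> Nat) \<Longrightarrow> const M Rec \<star> zero \<star> b \<star> c = b"
  using axiom_sat[OF E_PRA.rec_zero, of "base((''y'', Nat) := b, (''z'', Nat \<leadsto> Nat \<leadsto> Nat) := c)"]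
  by simp

lemma Rec_suc [simp]:
  "a \<in> N \<Longrightarrow> b \<in> N \<Longrightarrow> c \<in> dom M (Nat \<leadsto> Nat \<leadsto> Nat) \<Longrightarrow>
     const M Rec \<star> suc a \<star> b \<star> c = c \<star> (const M Rec \<star> a \<star> b \<star> c) \<star> a"
  using axiom_sat[OF E_PRA.rec_succ,
      of "base((''x'', Nat) := a, (''y'', Nat) := b, (''z'', Nat \<leadsto> Nat \<leadsto> Nat) := c)"]
  by simp

lemma Rec_in [simp]:
  "a \<in> N \<Longrightarrow> b \<in> N \<Longrightarrow> c \<in> dom M (Nat \<leadsto> Nat \<leadsto> Nat) \<Longrightarrow> const M Rec \<star> a \<star> b \<star> c \<in> N"
  by (meson ap_dom const_in_dom(5))

lemma val_lam [simp]:
  assumes "assignment M e" "tyof [] t = Some \<tau>" "a \<in> dom M (snd v)"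
  shows "val M e [] (lam v t) \<star> a = val M (e(v := a)) [] t"
  using assms(2)
proof (induction t arbitrary: \<tau>)
  case (V w)
  have "const M (\<S> (snd v) (snd v \<leadsto> snd v) (snd v)) \<star> const M (\<K> (snd v) (snd v \<leadsto> snd v))
      \<star> const M (\<K> (snd v) (snd v)) \<star> a = a"
    using assms by (subst S_eq) (auto intro!: K_eq ap_dom[of _ "snd v"])
  then show ?case using assms by (auto simp: lam.simps assignmentD)
next
  case (App s t)
  then obtain \<rho> where ty: "tyof [] s = Some (\<rho> \<leadsto> \<tau>)" "tyof [] t = Some \<rho>" by auto
  then have "tyof [] (s \<cdot> t) = Some \<tau>" by simp
  then have the: "the (tyof [] (s \<cdot> t)) = \<tau>" by (simp del: tyof_App_eq_Some)
  show ?case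
  proof (cases "v \<in> fv_tm (s \<cdot> t)")
    case True
    have "val M e [] (lam v s) \<in> dom M (snd v \<leadsto> \<rho> \<leadsto> \<tau>)" "val M e [] (lam v t) \<in> dom M (snd v \<leadsto> \<rho>)"
      using ty assms by (auto intro!: val_dom)
    then show ?thesis using True ty App.IH assms(1,3) by (simp add: lam.simps the)
  next
    case False
    then have "val M (e(v := a)) [] (s \<cdot> t) = val M e [] (s \<cdot> t)" by (intro val_cong) auto
    moreover have "val M e [] (s \<cdot> t) \<in> dom M \<tau>" using App.prems assms by (intro val_dom)
    ultimately show ?thesis using False assms(1,3) by (simp add: lam.simps the del: fun_upd_apply)
  qed
qed (use assms in \<open>simp_all add: lam.simps\<close>)

text \<open>
  Induction is available for quantifier-free formulas only, that is, for properties of \<open>n\<close> that a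
  formula \<open>A\<close> expresses with parameters supplied by the assignment.
\<close>

lemma qf_induct:
  assumes "quantifier_free A" "wff [] A" "assignment M e" "snd n = Nat"
    and "sat M (e(n := zero)) [] A"
    and step: "\<And>a. a \<in> N \<Longrightarrow> sat M (e(n := a)) [] A \<Longrightarrow> sat M (e(n := suc a)) [] A"
    and "a \<in> N"
  shows "sat M (e(n := a)) [] A"
proof -
  have wf: "wff [] (A[n \<^bold>:= Zero])" "wff [] (A[n \<^bold>:= Succ \<cdot> V n])"
    using assms by (auto intro!: wff_subst)
  have "sat M e [] (A[n \<^bold>:= Zero] \<^bold>\<and> (\<^bold>\<forall>n. A \<^bold>\<longrightarrow> A[n \<^bold>:= Succ \<cdot> V n]) \<^bold>\<longrightarrow> (\<^bold>\<forall>n. A))"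
    using assms wf by (intro axiom_sat E_PRA.qf_induction) (auto intro!: wff_Forall)
  then show ?thesis using assms wf by (simp add: sat_Forall sat_subst)
qed

end

section \<open>Arithmetic in a model\<close>

text \<open>Zero selects the first branch.\<close>

definition cond_tm :: tm where
  "cond_tm = (let c = (''c'', Nat); x = (''x'', Nat); y = (''y'', Nat); u = (''u'', Nat); i = (''i'', Nat) in
     lam c (lam x (lam y (Rec \<cdot> V c \<cdot> V x \<cdot> lam u (lam i (V y))))))"

lemma tyof_cond_tm [simp]: "tyof \<Gamma> cond_tm = Some (Nat \<leadsto> Nat \<leadsto> Nat \<leadsto> Nat)"
  by (rule tyof_closed) (simp add: cond_tm_def Let_def)

lemma closed_cond_tm [simp]: "fv_tm cond_tm = {}"
  by (auto simp: cond_tm_def Let_def)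

context arithmetic_model
begin

lemma cl_dom: "tyof [] t = Some \<tau> \<Longrightarrow> cl t \<in> dom M \<tau>"
  unfolding cl_def by (rule val_dom) simp

abbreviation plus (infixl "\<oplus>" 65) where "a \<oplus> b \<equiv> cl add_tm \<star> a \<star> b"
abbreviation monus (infixl "\<ominus>" 65) where "a \<ominus> b \<equiv> cl monus_tm \<star> a \<star> b"
abbreviation le (infix "\<preceq>" 50) where "a \<preceq> b \<equiv> a \<ominus> b = zero"
abbreviation prd :: "'a \<Rightarrow> 'a" where "prd a \<equiv> cl pred_tm \<star> a"
abbreviation tri :: "'a \<Rightarrow> 'a" where "tri a \<equiv> cl triangle_tm \<star> a"
abbreviation pair :: "'a \<Rightarrow> 'a \<Rightarrow> 'a" where "pair a b \<equiv> cl pair_tm \<star> a \<star> b"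
abbreviation ini :: "'a \<Rightarrow> 'a \<Rightarrow> 'a" where "ini f n \<equiv> cl initial_tm \<star> f \<star> n"
abbreviation cond :: "'a \<Rightarrow> 'a \<Rightarrow> 'a \<Rightarrow> 'a" where "cond c a b \<equiv> cl cond_tm \<star> c \<star> a \<star> b"

lemma val_closed_tms [simp]:
  "val M e l add_tm = cl add_tm" "val M e l monus_tm = cl monus_tm" "val M e l pred_tm = cl pred_tm"
  "val M e l triangle_tm = cl triangle_tm" "val M e l pair_tm = cl pair_tm"
  "val M e l initial_tm = cl initial_tm" "val M e l cond_tm = cl cond_tm"
  "val M e l const_one = cl const_one"
  by (rule val_closed; simp)+

lemma cl_in_dom [simp]:
  "cl add_tm \<in> dom M (Nat \<leadsto> Nat \<leadsto> Nat)" "cl monus_tm \<in> dom M (Nat \<leadsto> Nat \<leadsto> Nat)"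
  "cl pred_tm \<in> dom M one" "cl triangle_tm \<in> dom M one" "cl pair_tm \<in> dom M (Nat \<leadsto> Nat \<leadsto> Nat)"
  "cl initial_tm \<in> dom M (one \<leadsto> Nat \<leadsto> Nat)" "cl const_one \<in> dom M one"
  "cl cond_tm \<in> dom M (Nat \<leadsto> Nat \<leadsto> Nat \<leadsto> Nat)"
  by (auto intro: cl_dom)

lemma ini_in [simp]: "f \<in> dom M one \<Longrightarrow> n \<in> N \<Longrightarrow> ini f n \<in> N"
  by (meson ap_dom cl_in_dom(6))

lemma cond_in [simp]: "c \<in> N \<Longrightarrow> a \<in> N \<Longrightarrow> b \<in> N \<Longrightarrow> cond c a b \<in> N"
  by (meson ap_dom cl_in_dom(8))

lemma prd_zero [simp]: "prd zero = zero"
  by (subst cl_def, subst pred_tm_def) (simp add: Let_def val_dom)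

lemma prd_suc [simp]: "a \<in> N \<Longrightarrow> prd (suc a) = a"
  by (subst cl_def, subst pred_tm_def) (simp add: Let_def val_dom)

lemma cond_zero [simp]: "a \<in> N \<Longrightarrow> b \<in> N \<Longrightarrow> cond zero a b = a"
  by (subst cl_def, subst cond_tm_def) (simp add: Let_def val_dom)

lemma cond_suc [simp]: "c \<in> N \<Longrightarrow> a \<in> N \<Longrightarrow> b \<in> N \<Longrightarrow> cond (suc c) a b = b"
  by (subst cl_def, subst cond_tm_def) (simp add: Let_def val_dom)

lemma const_one_app [simp]: "i \<in> N \<Longrightarrow> cl const_one \<star> i = suc zero"
  by (subst cl_def, subst const_one_def) simp

lemma plus_eqs [simp]:
  assumes "a \<in> N"
  shows "a \<oplus> zero = a" "b \<in> N \<Longrightarrow> a \<oplus> suc b = suc (a \<oplus> b)"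
proof -
  let ?L = "lam (''u'', Nat) (lam (''i'', Nat) (Succ \<cdot> V (''u'', Nat)))"
  have L: "cl ?L \<in> dom M (Nat \<leadsto> Nat \<leadsto> Nat)" by (rule cl_dom) simp
  have app: "cl ?L \<star> x \<star> y = suc x" if "x \<in> N" "y \<in> N" for x y
    by (subst cl_def) (simp add: that)
  have rec: "a \<oplus> b = const M Rec \<star> b \<star> a \<star> cl ?L" if "b \<in> N" for b
    by (subst cl_def, subst add_tm_def) (simp add: Let_def assms that val_closed[of ?L "Nat \<leadsto> Nat \<leadsto> Nat"])
  show "a \<oplus> zero = a" "b \<in> N \<Longrightarrow> a \<oplus> suc b = suc (a \<oplus> b)"
    by (simp_all add: rec L assms app)
qed

lemma monus_eqs [simp]:
  assumes "a \<in> N"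
  shows "a \<ominus> zero = a" "b \<in> N \<Longrightarrow> a \<ominus> suc b = prd (a \<ominus> b)"
proof -
  let ?L = "lam (''u'', Nat) (lam (''i'', Nat) (pred_tm \<cdot> V (''u'', Nat)))"
  have L: "cl ?L \<in> dom M (Nat \<leadsto> Nat \<leadsto> Nat)" by (rule cl_dom) simp
  have app: "cl ?L \<star> x \<star> y = prd x" if "x \<in> N" "y \<in> N" for x y
    by (subst cl_def) (simp add: that)
  have rec: "a \<ominus> b = const M Rec \<star> b \<star> a \<star> cl ?L" if "b \<in> N" for b
    by (subst cl_def, subst monus_tm_def) (simp add: Let_def assms that val_closed[of ?L "Nat \<leadsto> Nat \<leadsto> Nat"])
  show "a \<ominus> zero = a" "b \<in> N \<Longrightarrow> a \<ominus> suc b = prd (a \<ominus> b)"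
    by (simp_all add: rec L assms app)
qed

lemma tri_eqs [simp]: "tri zero = zero" "a \<in> N \<Longrightarrow> tri (suc a) = tri a \<oplus> suc a"
proof -
  let ?L = "lam (''u'', Nat) (lam (''i'', Nat) (add_tm \<cdot> V (''u'', Nat) \<cdot> (Succ \<cdot> V (''i'', Nat))))"
  have L: "cl ?L \<in> dom M (Nat \<leadsto> Nat \<leadsto> Nat)" by (rule cl_dom) simp
  have app: "cl ?L \<star> x \<star> y = x \<oplus> suc y" if "x \<in> N" "y \<in> N" for x y
    by (subst cl_def) (simp add: that del: plus_eqs)
  have rec: "tri b = const M Rec \<star> b \<star> zero \<star> cl ?L" if "b \<in> N" for b
    by (subst cl_def, subst triangle_tm_def) (simp add: Let_def that val_closed[of ?L "Nat \<leadsto> Nat \<leadsto> Nat"])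
  show "tri zero = zero" "a \<in> N \<Longrightarrow> tri (suc a) = tri a \<oplus> suc a"
    by (simp_all add: rec L app del: plus_eqs)
qed

lemma pair_eq: "a \<in> N \<Longrightarrow> b \<in> N \<Longrightarrow> pair a b = tri (a \<oplus> b) \<oplus> b"
  by (subst cl_def, subst pair_tm_def) (simp add: Let_def)

lemma ini_eqs [simp]:
  assumes "f \<in> dom M one"
  shows "ini f zero = zero" "n \<in> N \<Longrightarrow> ini f (suc n) = suc (pair (ini f n) (f \<star> n))"
proof -
  let ?L = "lam (''u'', Nat) (lam (''i'', Nat) (Succ \<cdot> (pair_tm \<cdot> V (''u'', Nat) \<cdot> (V (''f'', one) \<cdot> V (''i'', Nat)))))"
  let ?e = "base((''f'', one) := f)"
  have L: "val M ?e [] ?L \<in> dom M (Nat \<leadsto> Nat \<leadsto> Nat)" by (rule val_dom) (simp_all add: assms)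
  have app: "val M ?e [] ?L \<star> x \<star> y = suc (pair x (f \<star> y))" if "x \<in> N" "y \<in> N" for x y
    by (simp add: that assms)
  have env: "val M (?e((''n'', Nat) := n)) [] ?L = val M ?e [] ?L" for n
    by (rule val_cong) auto
  have rec: "ini f n = const M Rec \<star> n \<star> zero \<star> val M ?e [] ?L" if "n \<in> N" for n
    by (subst cl_def, subst initial_tm_def) (simp add: Let_def assms that env del: fun_upd_apply, simp)
  show "ini f zero = zero" "n \<in> N \<Longrightarrow> ini f (suc n) = suc (pair (ini f n) (f \<star> n))"
    by (simp_all add: rec L assms app)
qed

abbreviation (input) vn where "vn \<equiv> (''n'', Nat)"
abbreviation (input) va where "va \<equiv> (''a'', Nat)"
abbreviation (input) vb where "vb \<equiv> (''b'', Nat)"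

lemma zero_plus [simp]: "a \<in> N \<Longrightarrow> zero \<oplus> a = a"
  using qf_induct[of "add_tm \<cdot> Zero \<cdot> V vn \<doteq> V vn" base vn a] by simp

lemma suc_plus [simp]: "a \<in> N \<Longrightarrow> b \<in> N \<Longrightarrow> suc a \<oplus> b = suc (a \<oplus> b)"
  using qf_induct[of "add_tm \<cdot> (Succ \<cdot> V va) \<cdot> V vn \<doteq> Succ \<cdot> (add_tm \<cdot> V va \<cdot> V vn)"
      "base(va := a)" vn b] by simp

lemma plus_comm: "a \<in> N \<Longrightarrow> b \<in> N \<Longrightarrow> a \<oplus> b = b \<oplus> a"
  using qf_induct[of "add_tm \<cdot> V va \<cdot> V vn \<doteq> add_tm \<cdot> V vn \<cdot> V va" "base(va := a)" vn b] by simp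

lemma plus_assoc: "a \<in> N \<Longrightarrow> b \<in> N \<Longrightarrow> c \<in> N \<Longrightarrow> a \<oplus> b \<oplus> c = a \<oplus> (b \<oplus> c)"
  using qf_induct[of "add_tm \<cdot> (add_tm \<cdot> V va \<cdot> V vb) \<cdot> V vn \<doteq> add_tm \<cdot> V va \<cdot> (add_tm \<cdot> V vb \<cdot> V vn)"
      "base(va := a, vb := b)" vn c] by simp

lemma nat_cases: "a \<in> N \<Longrightarrow> a = zero \<or> (\<exists>b \<in> N. a = suc b)"
  using qf_induct[of "\<^bold>\<not> V vn \<doteq> Zero \<^bold>\<longrightarrow> V vn \<doteq> Succ \<cdot> (pred_tm \<cdot> V vn)" base vn a]
    app_in[of "cl pred_tm" a]
  by (auto simp: Neg_def)

lemma monus_suc_suc: "a \<in> N \<Longrightarrow> b \<in> N \<Longrightarrow> suc a \<ominus> suc b = a \<ominus> b"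
  using qf_induct[of "monus_tm \<cdot> (Succ \<cdot> V va) \<cdot> (Succ \<cdot> V vn) \<doteq> monus_tm \<cdot> V va \<cdot> V vn"
      "base(va := a)" vn b] by simp

lemma plus_monus: "a \<in> N \<Longrightarrow> b \<in> N \<Longrightarrow> a \<oplus> b \<ominus> b = a"
  using qf_induct[of "monus_tm \<cdot> (add_tm \<cdot> V va \<cdot> V vn) \<cdot> V vn \<doteq> V va" "base(va := a)" vn b]
    monus_suc_suc by (simp del: monus_eqs(2))

lemma zero_monus [simp]: "a \<in> N \<Longrightarrow> zero \<ominus> a = zero"
  using qf_induct[of "monus_tm \<cdot> Zero \<cdot> V vn \<doteq> Zero" base vn a] by simp

lemma le_refl: "a \<in> N \<Longrightarrow> a \<preceq> a"
  using plus_monus[of zero a] by simp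

lemma le_plus: "a \<in> N \<Longrightarrow> b \<in> N \<Longrightarrow> a \<preceq> a \<oplus> b"
  using qf_induct[of "monus_tm \<cdot> V va \<cdot> (add_tm \<cdot> V va \<cdot> V vn) \<doteq> Zero" "base(va := a)" vn b]
    le_refl[of a] by simp

text \<open>
  The two lemmas that follow make the order linear: of any two numbers one is obtained from the other
  by adding their cut-off difference. Each is an induction in which the comparison of \<open>a\<close> and \<open>b\<close>
  is part of the quantifier-free formula.
\<close>

lemma plus_monus_le:
  assumes b: "b \<in> N" and a: "a \<in> N"
  shows "a \<preceq> b \<Longrightarrow> a \<oplus> (b \<ominus> a) = b"
proof -
  have step: "suc a \<preceq> b \<longrightarrow> suc a \<oplus> (b \<ominus> suc a) = b"
    if a: "a \<in> N" and IH: "a \<preceq> b \<longrightarrow> a \<oplus> (b \<ominus> a) = b" for a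
  proof
    assume le: "suc a \<preceq> b"
    have "a \<ominus> b = prd (suc a \<ominus> b)" using monus_suc_suc[OF a b] a b by simp
    then have eq: "a \<oplus> (b \<ominus> a) = b" using le IH by simp
    have d: "b \<ominus> a \<in> N" using a b by simp
    show "suc a \<oplus> (b \<ominus> suc a) = b"
    proof (cases "b \<ominus> a = zero")
      case True
      then have "b = a" using eq a by simp
      then show ?thesis using le plus_monus[of "suc zero" a] a by simp
    next
      case False
      then obtain w where "w \<in> N" "b \<ominus> a = suc w" using nat_cases[OF d] by auto
      then show ?thesis using eq a b by simp
    qed
  qed
  show "a \<preceq> b \<Longrightarrow> a \<oplus> (b \<ominus> a) = b"
    using qf_induct[of "monus_tm \<cdot> V vn \<cdot> V vb \<doteq> Zero \<^bold>\<longrightarrow>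
        add_tm \<cdot> V vn \<cdot> (monus_tm \<cdot> V vb \<cdot> V vn) \<doteq> V vb" "base(vb := b)" vn a] step a b
    by (simp del: monus_eqs(2))
qed

lemma plus_monus_not_le:
  assumes a: "a \<in> N" and b: "b \<in> N"
  shows "\<not> a \<preceq> b \<Longrightarrow> b \<oplus> (a \<ominus> b) = a"
proof -
  have step: "\<not> a \<preceq> suc b \<longrightarrow> suc b \<oplus> (a \<ominus> suc b) = a"
    if b: "b \<in> N" and IH: "\<not> a \<preceq> b \<longrightarrow> b \<oplus> (a \<ominus> b) = a" for b
  proof
    assume n: "\<not> a \<preceq> suc b"
    then have "a \<ominus> b \<noteq> zero" using a b by auto
    then obtain w where "w \<in> N" "a \<ominus> b = suc w" using nat_cases[of "a \<ominus> b"] a b by auto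
    then show "suc b \<oplus> (a \<ominus> suc b) = a" using IH a b by simp
  qed
  show "\<not> a \<preceq> b \<Longrightarrow> b \<oplus> (a \<ominus> b) = a"
    using qf_induct[of "\<^bold>\<not> monus_tm \<cdot> V va \<cdot> V vn \<doteq> Zero \<^bold>\<longrightarrow>
        add_tm \<cdot> V vn \<cdot> (monus_tm \<cdot> V va \<cdot> V vn) \<doteq> V va" "base(va := a)" vn b] step a b
    by (simp add: Neg_def del: monus_eqs(2))
qed

lemma plus_cancel: "a \<in> N \<Longrightarrow> b \<in> N \<Longrightarrow> c \<in> N \<Longrightarrow> a \<oplus> b = a \<oplus> c \<Longrightarrow> b = c"
  by (metis plus_comm plus_monus)

lemma le_iff: "a \<in> N \<Longrightarrow> b \<in> N \<Longrightarrow> a \<preceq> b \<longleftrightarrow> (\<exists>c \<in> N. b = a \<oplus> c)"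
  using plus_monus_le[of b a] le_plus[of a] app_nat2_in[OF cl_in_dom(2), of b a] by metis

lemma plus_eq_zero: "a \<in> N \<Longrightarrow> b \<in> N \<Longrightarrow> a \<oplus> b = zero \<Longrightarrow> a = zero \<and> b = zero"
  using nat_cases[of b] by auto

text \<open>The strict order is expressed as \<open>suc a \<preceq> b\<close> throughout.\<close>

lemma suc_le_iff: "a \<in> N \<Longrightarrow> b \<in> N \<Longrightarrow> suc a \<preceq> b \<longleftrightarrow> \<not> b \<preceq> a"
proof
  assume ab: "a \<in> N" "b \<in> N"
  show "\<not> b \<preceq> a" if le: "suc a \<preceq> b"
  proof
    assume "b \<preceq> a"
    then obtain w where w: "w \<in> N" "a = b \<oplus> w" using ab le_iff by blast
    obtain z where z: "z \<in> N" "b = suc a \<oplus> z" using le ab le_iff[of "suc a" b] by auto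
    have "a = suc a \<oplus> z \<oplus> w" by (subst z(2)[symmetric]) (rule w(2))
    then have "a \<oplus> zero = a \<oplus> (suc z \<oplus> w)" using w(1) z(1) ab by (simp add: plus_assoc)
    then have "zero = suc z \<oplus> w" by (rule plus_cancel[rotated 3]) (use w(1) z(1) ab in simp_all)
    then show False using w z zero_neq_suc[of "z \<oplus> w"] by simp
  qed
  show "suc a \<preceq> b" if n: "\<not> b \<preceq> a"
  proof -
    have "b \<ominus> a \<in> N" using ab by simp
    then obtain w where "w \<in> N" "b \<ominus> a = suc w" using nat_cases[of "b \<ominus> a"] n by auto
    then have "w \<in> N" "b = suc a \<oplus> w" using plus_monus_not_le[of b a] n ab by simp_all
    then show ?thesis using ab le_iff[of "suc a" b] by auto
  qed
qed

lemma le_trans: "a \<in> N \<Longrightarrow> b \<in> N \<Longrightarrow> c \<in> N \<Longrightarrow> a \<preceq> b \<Longrightarrow> b \<preceq> c \<Longrightarrow> a \<preceq> c"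
  by (auto simp: le_iff plus_assoc)

lemma le_antisym: "a \<in> N \<Longrightarrow> b \<in> N \<Longrightarrow> a \<preceq> b \<Longrightarrow> b \<preceq> a \<Longrightarrow> a = b"
  using plus_monus_le[of b a] by simp

lemma le_suc: "a \<in> N \<Longrightarrow> a \<preceq> suc a"
  using le_plus[of a "suc zero"] by simp

lemma suc_le_suc: "a \<in> N \<Longrightarrow> b \<in> N \<Longrightarrow> suc a \<preceq> suc b \<longleftrightarrow> a \<preceq> b"
  using monus_suc_suc by simp

lemma suc_le_suc_cases: "a \<in> N \<Longrightarrow> b \<in> N \<Longrightarrow> suc a \<preceq> suc b \<Longrightarrow> a = b \<or> suc a \<preceq> b"
  using suc_le_suc suc_le_iff le_antisym by metis

lemma tri_mono: "a \<in> N \<Longrightarrow> b \<in> N \<Longrightarrow> tri a \<preceq> tri (a \<oplus> b)"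
proof -
  assume ab: "a \<in> N" "b \<in> N"
  have step: "tri a \<preceq> tri (a \<oplus> suc c)" if "c \<in> N" "tri a \<preceq> tri (a \<oplus> c)" for c
    using le_trans[OF _ _ _ that(2), of "tri (a \<oplus> suc c)"] le_plus[of "tri (a \<oplus> c)" "suc (a \<oplus> c)"]
      ab that(1) by simp
  then show ?thesis
    using qf_induct[of "monus_tm \<cdot> (triangle_tm \<cdot> V va) \<cdot> (triangle_tm \<cdot> (add_tm \<cdot> V va \<cdot> V vn)) \<doteq> Zero"
        "base(va := a)" vn b] ab le_refl by (simp del: plus_eqs(2) suc_plus tri_eqs)
qed

text \<open>
  If \<open>a + b < c + d\<close>, the code of \<open>(a, b)\<close> lies below \<open>1 + 2 + \<dots> + (a + b + 1)\<close>, which does not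
  exceed the code of \<open>(c, d)\<close>.
\<close>

lemma pair_less:
  assumes N: "a \<in> N" "b \<in> N" "c \<in> N" "d \<in> N" and less: "suc (a \<oplus> b) \<preceq> c \<oplus> d"
  shows "pair a b \<noteq> pair c d"
proof
  assume eq: "pair a b = pair c d"
  obtain w where w: "w \<in> N" "c \<oplus> d = suc (a \<oplus> b) \<oplus> w"
    using less le_iff[of "suc (a \<oplus> b)" "c \<oplus> d"] N by auto
  obtain v where v: "v \<in> N" "tri (c \<oplus> d) = tri (suc (a \<oplus> b)) \<oplus> v"
    using tri_mono[of "suc (a \<oplus> b)" w] le_iff[of "tri (suc (a \<oplus> b))" "tri (c \<oplus> d)"] N w by auto
  have "tri (a \<oplus> b) \<oplus> b = tri (a \<oplus> b) \<oplus> (suc (a \<oplus> b) \<oplus> v \<oplus> d)"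
    using eq v N by (simp add: pair_eq plus_assoc del: plus_eqs(2))
  then have "b = suc (a \<oplus> b) \<oplus> v \<oplus> d"
    using plus_cancel[of "tri (a \<oplus> b)" b "suc (a \<oplus> b) \<oplus> v \<oplus> d"] N v by simp
  also have "\<dots> = b \<oplus> suc (a \<oplus> v \<oplus> d)" using N v plus_comm[of a b] by (simp add: plus_assoc)
  finally have "zero = suc (a \<oplus> v \<oplus> d)"
    using plus_cancel[of b zero "suc (a \<oplus> v \<oplus> d)"] N v by simp
  then show False using N v zero_neq_suc[of "a \<oplus> v \<oplus> d"] by simp
qed

lemma pair_inject:
  assumes N: "a \<in> N" "b \<in> N" "c \<in> N" "d \<in> N" and eq: "pair a b = pair c d"
  shows "a = c \<and> b = d"
proof -
  have "a \<oplus> b = c \<oplus> d"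
    using pair_less[of a b c d] pair_less[of c d a b] suc_le_iff le_antisym N eq
    by (metis app_nat2_in cl_in_dom(1))
  moreover from this have "b = d"
    using eq N plus_cancel[of "tri (a \<oplus> b)" b d] by (simp add: pair_eq)
  ultimately show ?thesis using N plus_cancel[of b a c] plus_comm by metis
qed

text \<open>
  The hypothesis is universal and may not enter the induction formula. Bounding the induction variable
  by \<open>n\<close> keeps that formula quantifier-free: the hypothesis is applied outside of it, in the step.
\<close>

lemma ini_cong:
  assumes f: "f \<in> dom M one" and g: "g \<in> dom M one" and n: "n \<in> N"
    and eq: "\<And>i. i \<in> N \<Longrightarrow> suc i \<preceq> n \<Longrightarrow> f \<star> i = g \<star> i"
  shows "ini f n = ini g n"
proof -
  let ?f = "(''f'', one)" and ?g = "(''g'', one)"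
  have step: "suc m \<preceq> n \<longrightarrow> ini f (suc m) = ini g (suc m)"
    if m: "m \<in> N" and IH: "m \<preceq> n \<longrightarrow> ini f m = ini g m" for m
    using IH eq[OF m] f g m n le_trans[of m "suc m" n] le_suc[of m] by auto
  have "n \<preceq> n \<longrightarrow> ini f n = ini g n"
    using qf_induct[of "monus_tm \<cdot> V vn \<cdot> V va \<doteq> Zero \<^bold>\<longrightarrow>
       initial_tm \<cdot> V ?f \<cdot> V vn \<doteq> initial_tm \<cdot> V ?g \<cdot> V vn" "base(?f := f, ?g := g, va := n)" vn n]
      f g n step by (simp del: ini_eqs(2))
  then show ?thesis using le_refl n by simp
qed

lemma ini_inject:
  assumes f: "f \<in> dom M one" and g: "g \<in> dom M one" and n: "n \<in> N"
    and eq: "ini f n = ini g n" and i: "i \<in> N" "suc i \<preceq> n"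
  shows "f \<star> i = g \<star> i"
proof -
  let ?f = "(''f'', one)" and ?g = "(''g'', one)"
  have step: "ini f (suc m) = ini g (suc m) \<longrightarrow> suc i \<preceq> suc m \<longrightarrow> f \<star> i = g \<star> i"
    if m: "m \<in> N" and IH: "ini f m = ini g m \<longrightarrow> suc i \<preceq> m \<longrightarrow> f \<star> i = g \<star> i" for m
  proof (intro impI)
    assume "ini f (suc m) = ini g (suc m)" and le: "suc i \<preceq> suc m"
    then have "pair (ini f m) (f \<star> m) = pair (ini g m) (g \<star> m)" using f g m by simp
    then have "ini f m = ini g m" "f \<star> m = g \<star> m"
      using pair_inject[of "ini f m" "f \<star> m" "ini g m" "g \<star> m"] f g m by simp_all
    then show "f \<star> i = g \<star> i" using IH suc_le_suc_cases[OF i(1) m le] by auto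
  qed
  let ?A = "initial_tm \<cdot> V ?f \<cdot> V vn \<doteq> initial_tm \<cdot> V ?g \<cdot> V vn \<^bold>\<longrightarrow>
       monus_tm \<cdot> (Succ \<cdot> V va) \<cdot> V vn \<doteq> Zero \<^bold>\<longrightarrow> V ?f \<cdot> V va \<doteq> V ?g \<cdot> V va"
  let ?e = "base(?f := f, ?g := g, va := i)"
  have sat: "sat M (?e(vn := m)) [] ?A \<longleftrightarrow> (ini f m = ini g m \<longrightarrow> suc i \<preceq> m \<longrightarrow> f \<star> i = g \<star> i)" for m
    by simp
  have "sat M (?e(vn := n)) [] ?A"
  proof (rule qf_induct)
    show "sat M (?e(vn := suc m)) [] ?A" if "m \<in> N" "sat M (?e(vn := m)) [] ?A" for m
      using step[OF that(1)] that(2) unfolding sat .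
  qed (use f g n i(1) in simp_all)
  then have "ini f n = ini g n \<longrightarrow> suc i \<preceq> n \<longrightarrow> f \<star> i = g \<star> i" by (simp only: sat)
  then show ?thesis using eq i by simp
qed

end

section \<open>Operations on Cantor space\<close>

text \<open>
  Replacing all nonzero values by one is a retraction onto Cantor space. It turns statements about
  elements of Cantor space into statements about arbitrary sequences, which do not need the universal
  hypothesis \<open>f \<le>\<^sub>1 1\<close>.
\<close>

definition clip_tm :: tm where
  "clip_tm = (let z = (''z'', one); i = (''i'', Nat) in
     lam z (lam i (cond_tm \<cdot> (V z \<cdot> V i) \<cdot> Zero \<cdot> (Succ \<cdot> Zero))))"

definition shift_tm :: tm where
  "shift_tm = (let z = (''z'', one); k = (''k'', Nat); i = (''i'', Nat) in
     lam z (lam k (lam i (V z \<cdot> (add_tm \<cdot> V k \<cdot> V i)))))"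

text \<open>
  The test \<open>Succ i - k = 0\<close> says that \<open>i\<close> is below \<open>k\<close>.
\<close>

definition trunc_tm :: tm where
  "trunc_tm = (let z = (''z'', one); k = (''k'', Nat); i = (''i'', Nat) in
     lam z (lam k (lam i (cond_tm \<cdot> (monus_tm \<cdot> (Succ \<cdot> V i) \<cdot> V k) \<cdot> (V z \<cdot> V i) \<cdot> Zero))))"

definition dist_tm :: tm where
  "dist_tm = (let x = (''x'', Nat); y = (''y'', Nat) in
     lam x (lam y (add_tm \<cdot> (monus_tm \<cdot> V x \<cdot> V y) \<cdot> (monus_tm \<cdot> V y \<cdot> V x))))"

text \<open>
  The functional \<open>z \<mapsto> |\<phi> s - \<phi> (s restricted to k)|\<close>, where \<open>s\<close> is the sequence \<open>z\<close>, moved into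
  Cantor space, without its first \<open>k\<close> values. It is zero on all sequences
  exactly if \<open>\<phi>\<close> does not distinguish elements of
  Cantor space from their truncations at \<open>k\<close>, that is, if \<open>k\<close> is a uniform modulus of \<open>\<phi>\<close>. Since
  \<open>s\<close> ignores the first \<open>k\<close> values of \<open>z\<close>, it suffices to look at those \<open>z\<close> that begin with \<open>k\<close>
  zeros, and a pointwise modulus at the zero sequence that is at most \<open>k\<close> covers all of these.
\<close>

definition gap_tm :: tm where
  "gap_tm = (let p = (''p'', two); z = (''z'', one); k = (''k'', Nat);
       s = shift_tm \<cdot> (clip_tm \<cdot> V z) \<cdot> V k in
     lam p (lam k (lam z (dist_tm \<cdot> (V p \<cdot> s) \<cdot> (V p \<cdot> (trunc_tm \<cdot> s \<cdot> V k))))))"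

lemma tyof_clip_tm [simp]: "tyof \<Gamma> clip_tm = Some (one \<leadsto> one)"
  by (rule tyof_closed) (simp add: clip_tm_def Let_def)

lemma tyof_shift_tm [simp]: "tyof \<Gamma> shift_tm = Some (one \<leadsto> Nat \<leadsto> one)"
  by (rule tyof_closed) (simp add: shift_tm_def Let_def)

lemma tyof_trunc_tm [simp]: "tyof \<Gamma> trunc_tm = Some (one \<leadsto> Nat \<leadsto> one)"
  by (rule tyof_closed) (simp add: trunc_tm_def Let_def)

lemma tyof_dist_tm [simp]: "tyof \<Gamma> dist_tm = Some (Nat \<leadsto> Nat \<leadsto> Nat)"
  by (rule tyof_closed) (simp add: dist_tm_def Let_def)

lemma tyof_gap_tm [simp]: "tyof \<Gamma> gap_tm = Some (two \<leadsto> Nat \<leadsto> two)"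
  by (rule tyof_closed) (simp add: gap_tm_def Let_def)

lemma closed_tools [simp]:
  "fv_tm clip_tm = {}" "fv_tm shift_tm = {}" "fv_tm trunc_tm = {}" "fv_tm dist_tm = {}"
  by (auto simp: clip_tm_def shift_tm_def trunc_tm_def dist_tm_def Let_def)

lemma closed_gap_tm [simp]: "fv_tm gap_tm = {}"
  by (auto simp: gap_tm_def Let_def)

lemma quantifier_free_subst: "quantifier_free (\<phi>[v \<^bold>:= t]) = quantifier_free \<phi>"
proof -
  have "quantifier_free (abs_fm v k \<phi>) = quantifier_free \<phi>" for k
    by (induction \<phi> arbitrary: k) auto
  moreover have "quantifier_free (inst_fm t k \<psi>) = quantifier_free \<psi>" for k \<psi>
    by (induction \<psi> arbitrary: k) auto
  ultimately show ?thesis by (simp add: subst_def)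
qed

lemma lift_const_one [simp]: "lift const_one = const_one"
  by (rule lift_closed[OF tyof_const_one])

lemma wff_le1 [simp]: "snd f = one \<Longrightarrow> wff [] (V f \<^bold>\<le>\<^sub>1 const_one)"
  by (simp add: le1_def le0_def)

lemma wff_le0: "tyof \<Gamma> s = Some Nat \<Longrightarrow> tyof \<Gamma> t = Some Nat \<Longrightarrow> wff \<Gamma> (s \<^bold>\<le> t)"
  by (simp add: le0_def)

lemma wff_fan:
  "wff [] A \<Longrightarrow> snd f = one \<Longrightarrow> snd n = Nat \<Longrightarrow> snd k = Nat \<Longrightarrow>
   wff [] ((\<^bold>\<forall>f. V f \<^bold>\<le>\<^sub>1 const_one \<^bold>\<longrightarrow> (\<^bold>\<exists>n. A)) \<^bold>\<longrightarrow>
      (\<^bold>\<exists>k. \<^bold>\<forall>f. V f \<^bold>\<le>\<^sub>1 const_one \<^bold>\<longrightarrow> (\<^bold>\<exists>n. V n \<^bold>\<le> V k \<^bold>\<and> A)))"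
  by (simp add: wff_Forall wff_Exists le0_def)

context arithmetic_model
begin

definition Cantor :: "'a set" where
  "Cantor = {f \<in> dom M one. \<forall>i \<in> N. f \<star> i \<preceq> suc zero}"

lemma Cantor_one: "f \<in> Cantor \<Longrightarrow> f \<in> dom M one" by (simp add: Cantor_def)

lemma sat_le1 [simp]:
  "snd f = one \<Longrightarrow> e f \<in> dom M one \<Longrightarrow> sat M e [] (V f \<^bold>\<le>\<^sub>1 const_one) \<longleftrightarrow> e f \<in> Cantor"
  by (simp add: le1_def le0_def Cantor_def del: monus_eqs)

lemma Cantor_cases: "f \<in> Cantor \<Longrightarrow> i \<in> N \<Longrightarrow> f \<star> i = zero \<or> f \<star> i = suc zero"
  using nat_cases[of "f \<star> i"] by (auto simp: Cantor_def)

lemma CantorI: "f \<in> dom M one \<Longrightarrow> (\<And>i. i \<in> N \<Longrightarrow> f \<star> i = zero \<or> f \<star> i = suc zero) \<Longrightarrow> f \<in> Cantor"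
  by (fastforce simp: Cantor_def)

lemma val_closed_tools [simp]:
  "val M e l clip_tm = cl clip_tm" "val M e l shift_tm = cl shift_tm"
  "val M e l trunc_tm = cl trunc_tm" "val M e l gap_tm = cl gap_tm"
  "val M e l dist_tm = cl dist_tm"
  by (rule val_closed; simp)+

abbreviation clip where "clip z \<equiv> cl clip_tm \<star> z"
abbreviation shift where "shift z k \<equiv> cl shift_tm \<star> z \<star> k"
abbreviation trunc where "trunc z k \<equiv> cl trunc_tm \<star> z \<star> k"
abbreviation gap where "gap \<phi> k \<equiv> cl gap_tm \<star> \<phi> \<star> k"

lemma clip_in [simp]: "z \<in> dom M one \<Longrightarrow> clip z \<in> dom M one"
  by (rule ap_dom[OF cl_dom[OF tyof_clip_tm]])

lemma shift_in [simp]: "z \<in> dom M one \<Longrightarrow> k \<in> N \<Longrightarrow> shift z k \<in> dom M one"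
  by (rule ap_dom[OF ap_dom[OF cl_dom[OF tyof_shift_tm]]])

lemma trunc_in [simp]: "z \<in> dom M one \<Longrightarrow> k \<in> N \<Longrightarrow> trunc z k \<in> dom M one"
  by (rule ap_dom[OF ap_dom[OF cl_dom[OF tyof_trunc_tm]]])

lemma gap_in [simp]: "\<phi> \<in> dom M two \<Longrightarrow> k \<in> N \<Longrightarrow> gap \<phi> k \<in> dom M two"
  by (rule ap_dom[OF ap_dom[OF cl_dom[OF tyof_gap_tm]]])

lemma clip_app [simp]: "z \<in> dom M one \<Longrightarrow> i \<in> N \<Longrightarrow> clip z \<star> i = cond (z \<star> i) zero (suc zero)"
  by (subst cl_def, subst clip_tm_def) (simp add: Let_def)

lemma shift_app [simp]: "z \<in> dom M one \<Longrightarrow> k \<in> N \<Longrightarrow> i \<in> N \<Longrightarrow> shift z k \<star> i = z \<star> (k \<oplus> i)"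
  by (subst cl_def, subst shift_tm_def) (simp add: Let_def)

lemma trunc_app [simp]:
  "z \<in> dom M one \<Longrightarrow> k \<in> N \<Longrightarrow> i \<in> N \<Longrightarrow> trunc z k \<star> i = cond (suc i \<ominus> k) (z \<star> i) zero"
  by (subst cl_def, subst trunc_tm_def) (simp add: Let_def)

lemma dist_eq: "a \<in> N \<Longrightarrow> b \<in> N \<Longrightarrow> cl dist_tm \<star> a \<star> b = (a \<ominus> b) \<oplus> (b \<ominus> a)"
  by (subst cl_def, subst dist_tm_def) (simp add: Let_def)

lemma dist_eq_zero: "a \<in> N \<Longrightarrow> b \<in> N \<Longrightarrow> cl dist_tm \<star> a \<star> b = zero \<longleftrightarrow> a = b"
  using plus_eq_zero[of "a \<ominus> b" "b \<ominus> a"] le_antisym[of a b] le_refl[of a] by (auto simp: dist_eq)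

lemma dist_in [simp]: "a \<in> N \<Longrightarrow> b \<in> N \<Longrightarrow> cl dist_tm \<star> a \<star> b \<in> N"
  by (simp add: dist_eq)

lemma gap_app:
  "\<phi> \<in> dom M two \<Longrightarrow> k \<in> N \<Longrightarrow> z \<in> dom M one \<Longrightarrow>
     gap \<phi> k \<star> z = cl dist_tm \<star> (\<phi> \<star> shift (clip z) k) \<star> (\<phi> \<star> trunc (shift (clip z) k) k)"
  by (subst cl_def, subst gap_tm_def) (simp add: Let_def)

lemma cond_pos: "c \<in> N \<Longrightarrow> c \<noteq> zero \<Longrightarrow> a \<in> N \<Longrightarrow> b \<in> N \<Longrightarrow> cond c a b = b"
  using nat_cases[of c] by auto

lemma cond_bit: "c \<in> N \<Longrightarrow> a = zero \<or> a = suc zero \<Longrightarrow> b = zero \<or> b = suc zero \<Longrightarrow>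
    cond c a b = zero \<or> cond c a b = suc zero"
  using nat_cases[of c] by auto

lemma clip_Cantor: "z \<in> dom M one \<Longrightarrow> clip z \<in> Cantor"
  by (rule CantorI) (simp_all add: cond_bit)

lemma clip_id: "z \<in> Cantor \<Longrightarrow> clip z = z"
proof (rule extensional)
  assume z: "z \<in> Cantor"
  then show one: "clip z \<in> dom M one" "z \<in> dom M one" by (simp_all add: Cantor_one)
  show "clip z \<star> i = z \<star> i" if "i \<in> N" for i
    using Cantor_cases[OF z that] that one(2) by auto
qed

lemma shift_Cantor: "z \<in> Cantor \<Longrightarrow> k \<in> N \<Longrightarrow> shift z k \<in> Cantor"
  using Cantor_one[of z] by (intro CantorI) (simp_all add: Cantor_cases)

lemma trunc_Cantor: "z \<in> Cantor \<Longrightarrow> k \<in> N \<Longrightarrow> trunc z k \<in> Cantor"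
  using Cantor_one[of z] by (intro CantorI) (simp_all add: cond_bit Cantor_cases)

text \<open>
  Every term defines a function of the frame. This supplies functionals with parameters from the model.
\<close>

lemma Lambda:
  assumes "assignment M e" "tyof [] t = Some \<tau>"
  shows "\<exists>h \<in> dom M (snd v \<leadsto> \<tau>). \<forall>a \<in> dom M (snd v). h \<star> a = val M (e(v := a)) [] t"
  using assms by (intro bexI[of _ "val M e [] (lam v t)"] ballI val_lam val_dom) simp_all

section \<open>The principles in a model\<close>

lemma qf_choice:
  assumes AC: "QF_AC \<sigma> \<subseteq> T" and A: "quantifier_free A" "wff [] A"
    and x: "snd x = \<sigma>" "snd n = Nat" "x \<noteq> n" and e: "assignment M e"
    and ex: "\<And>a. a \<in> dom M \<sigma> \<Longrightarrow> \<exists>b \<in> N. sat M (e(x := a, n := b)) [] A"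
  shows "\<exists>F \<in> dom M (\<sigma> \<leadsto> Nat). \<forall>a \<in> dom M \<sigma>. sat M (e(x := a, n := F \<star> a)) [] A"
proof -
  obtain v where v: "snd v = \<sigma> \<leadsto> Nat" "v \<notin> fv A \<union> {x, n}"
    using ex_fresh[of "fv A \<union> {x, n}" "\<sigma> \<leadsto> Nat"] by auto
  let ?B = "A[n \<^bold>:= V v \<cdot> V x]"
  have wf: "wff [] ?B" using A x v by (intro wff_subst) simp_all
  have "((\<^bold>\<forall>x. \<^bold>\<exists>n. A) \<^bold>\<longrightarrow> (\<^bold>\<exists>v. \<^bold>\<forall>x. ?B)) \<in> QF_AC \<sigma>"
    unfolding QF_AC_def using A x v by blast
  then have "sat M e [] ((\<^bold>\<forall>x. \<^bold>\<exists>n. A) \<^bold>\<longrightarrow> (\<^bold>\<exists>v. \<^bold>\<forall>x. ?B))"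
    using AC A wf e by (intro valid) (auto intro!: wff_Forall wff_Exists)
  then obtain F where F: "F \<in> dom M (\<sigma> \<leadsto> Nat)" "\<forall>a \<in> dom M \<sigma>. sat M (e(v := F, x := a)) [] ?B"
    using ex A wf x v by (auto simp: sat_Forall sat_Exists wff_Forall wff_Exists)
  have "sat M (e(x := a, n := F \<star> a)) [] A" if "a \<in> dom M \<sigma>" for a
  proof -
    have "sat M (e(v := F, x := a, n := F \<star> a)) [] A"
      using F(2) that A x v by (simp add: sat_subst)
    moreover have "sat M (e(v := F, x := a, n := F \<star> a)) [] A = sat M (e(x := a, n := F \<star> a)) [] A"
      by (rule sat_cong) (use v in auto)
    ultimately show ?thesis by simp
  qed
  then show ?thesis using F(1) by blast
qed

lemma ball_Cantor: "(\<forall>a \<in> dom M one. a \<in> Cantor \<longrightarrow> P a) \<longleftrightarrow> (\<forall>a \<in> Cantor. P a)"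
  using Cantor_one by blast

lemma sat_Forall_Cantor:
  "wff [] \<phi> \<Longrightarrow> snd f = one \<Longrightarrow>
     sat M e [] (\<^bold>\<forall>f. V f \<^bold>\<le>\<^sub>1 const_one \<^bold>\<longrightarrow> \<phi>) \<longleftrightarrow> (\<forall>a \<in> Cantor. sat M (e(f := a)) [] \<phi>)"
  using Cantor_one by (auto simp: sat_Forall)

lemma sat_fan:
  assumes A: "wff [] A" and f: "snd f = one" "snd n = Nat" "snd k = Nat" "k \<noteq> n" "k \<notin> fv A"
  shows "sat M e [] ((\<^bold>\<forall>f. V f \<^bold>\<le>\<^sub>1 const_one \<^bold>\<longrightarrow> (\<^bold>\<exists>n. A)) \<^bold>\<longrightarrow>
      (\<^bold>\<exists>k. \<^bold>\<forall>f. V f \<^bold>\<le>\<^sub>1 const_one \<^bold>\<longrightarrow> (\<^bold>\<exists>n. V n \<^bold>\<le> V k \<^bold>\<and> A))) \<longleftrightarrow>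
    ((\<forall>a \<in> Cantor. \<exists>b \<in> N. sat M (e(f := a, n := b)) [] A) \<longrightarrow>
     (\<exists>c \<in> N. \<forall>a \<in> Cantor. \<exists>b \<in> N. b \<preceq> c \<and> sat M (e(f := a, n := b)) [] A))"
proof -
  have ne: "f \<noteq> n" "f \<noteq> k" using f by auto
  have "sat M (e(k := c, f := a, n := b)) [] A = sat M (e(f := a, n := b)) [] A" for a b c
    by (rule sat_cong) (use f in auto)
  moreover have "sat M (e(k := c, f := a, n := b)) [] (V n \<^bold>\<le> V k) \<longleftrightarrow> b \<preceq> c" for a b c
    using ne f by (simp add: le0_def)
  ultimately show ?thesis using A f
    by (simp add: sat_Forall_Cantor sat_Exists wff_Forall wff_Exists wff_le0 del: fun_upd_apply)
qed

lemma sat_MUC: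
  assumes "assignment M e"
  shows "sat M e [] MUC \<longleftrightarrow> (\<exists>\<Omega> \<in> dom M three. \<forall>\<phi> \<in> dom M two. \<forall>f \<in> Cantor. \<forall>g \<in> Cantor.
    ini f (\<Omega> \<star> \<phi>) = ini g (\<Omega> \<star> \<phi>) \<longrightarrow> \<phi> \<star> f = \<phi> \<star> g)"
  by (simp add: MUC_def Let_def sat_Exists wff_Exists sat_Forall wff_Forall initial_def
      ball_Cantor)

lemma sat_MPC0:
  assumes "assignment M e"
  shows "sat M e [] MPC0 \<longleftrightarrow> (\<exists>\<Delta> \<in> dom M (two \<leadsto> one \<leadsto> Nat). \<forall>\<phi> \<in> dom M two.
    (\<forall>f \<in> Cantor. \<exists>n \<in> N. \<forall>g \<in> Cantor. ini f n = ini g n \<longrightarrow> \<phi> \<star> f = \<phi> \<star> g) \<longrightarrow>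
    (\<forall>f \<in> Cantor. \<forall>g \<in> Cantor. ini f (\<Delta> \<star> \<phi> \<star> f) = ini g (\<Delta> \<star> \<phi> \<star> f) \<longrightarrow> \<phi> \<star> f = \<phi> \<star> g))"
  by (simp add: MPC0_def cont_on_Cantor_def Let_def sat_Exists wff_Exists sat_Forall
      wff_Forall initial_def ball_Cantor)

lemma fan_model:
  assumes FAN: "QF_FAN \<subseteq> T" and A: "quantifier_free A" "wff [] A"
    and f: "snd f = one" "snd n = Nat" and e: "assignment M e"
    and ex: "\<And>a. a \<in> Cantor \<Longrightarrow> \<exists>b \<in> N. sat M (e(f := a, n := b)) [] A"
  shows "\<exists>c \<in> N. \<forall>a \<in> Cantor. \<exists>b \<in> N. b \<preceq> c \<and> sat M (e(f := a, n := b)) [] A"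
proof -
  obtain k where k: "snd k = Nat" "k \<notin> insert n (fv A)" using ex_fresh[of "insert n (fv A)" Nat] by auto
  let ?\<psi> = "(\<^bold>\<forall>f. V f \<^bold>\<le>\<^sub>1 const_one \<^bold>\<longrightarrow> (\<^bold>\<exists>n. A)) \<^bold>\<longrightarrow>
      (\<^bold>\<exists>k. \<^bold>\<forall>f. V f \<^bold>\<le>\<^sub>1 const_one \<^bold>\<longrightarrow> (\<^bold>\<exists>n. V n \<^bold>\<le> V k \<^bold>\<and> A))"
  have "?\<psi> \<in> QF_FAN" unfolding QF_FAN_def using A f k by blast
  then have "sat M e [] ?\<psi>" using FAN A f k e by (intro valid wff_fan) auto
  then show ?thesis using sat_fan[of A f n k e] A f k ex by auto
qed

section \<open>Continuity from the fan theorem\<close>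

text \<open>
  The fan theorem is applied to \<open>\<forall>g. \<exists>n. \<phi> g \<noteq> \<phi> f \<longrightarrow> g n \<noteq> f n\<close>. This is true by extensionality, and
  its matrix is quantifier-free with parameters \<open>\<phi>\<close> and \<open>f\<close>. A bound \<open>c\<close> for \<open>n\<close> says that agreement
  with \<open>f\<close> up to \<open>c\<close> implies \<open>\<phi> g = \<phi> f\<close>.
\<close>

lemma fan_continuous:
  assumes FAN: "QF_FAN \<subseteq> T" and \<phi>: "\<phi> \<in> dom M two" and f: "f \<in> Cantor"
  shows "\<exists>n \<in> N. \<forall>g \<in> Cantor. ini f n = ini g n \<longrightarrow> \<phi> \<star> f = \<phi> \<star> g"
proof -
  let ?p = "(''p'', two)" and ?f = "(''f'', one)" and ?g = "(''g'', one)" and ?n = "(''n'', Nat)"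
  let ?A = "\<^bold>\<not> V ?p \<cdot> V ?g \<doteq> V ?p \<cdot> V ?f \<^bold>\<longrightarrow> \<^bold>\<not> V ?g \<cdot> V ?n \<doteq> V ?f \<cdot> V ?n"
  let ?e = "base(?p := \<phi>, ?f := f)"
  note one = Cantor_one[OF f]
  have sat: "sat M (?e(?g := g, ?n := n)) [] ?A \<longleftrightarrow> (\<phi> \<star> g \<noteq> \<phi> \<star> f \<longrightarrow> g \<star> n \<noteq> f \<star> n)" for g n
    by simp
  have "\<exists>c \<in> N. \<forall>g \<in> Cantor. \<exists>n \<in> N. n \<preceq> c \<and> sat M (?e(?g := g, ?n := n)) [] ?A"
  proof (rule fan_model[OF FAN])
    show "quantifier_free ?A" "wff [] ?A" by (simp_all add: Neg_def)
    show "assignment M ?e" using \<phi> one by simp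
    fix g assume "g \<in> Cantor"
    then have g: "g \<in> dom M one" by (rule Cantor_one)
    have "\<exists>n \<in> N. \<phi> \<star> g \<noteq> \<phi> \<star> f \<longrightarrow> g \<star> n \<noteq> f \<star> n"
      using extensional[OF g one] const_in_dom(1) by metis
    then show "\<exists>n \<in> N. sat M (?e(?g := g, ?n := n)) [] ?A" unfolding sat .
  qed simp_all
  then obtain c where c: "c \<in> N"
    "\<And>g. g \<in> Cantor \<Longrightarrow> \<exists>n \<in> N. n \<preceq> c \<and> (\<phi> \<star> g \<noteq> \<phi> \<star> f \<longrightarrow> g \<star> n \<noteq> f \<star> n)"
    unfolding sat by blast
  have "\<phi> \<star> f = \<phi> \<star> g" if g: "g \<in> Cantor" and eq: "ini f (suc c) = ini g (suc c)" for g
  proof -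
    obtain n where n: "n \<in> N" "n \<preceq> c" "\<phi> \<star> g \<noteq> \<phi> \<star> f \<longrightarrow> g \<star> n \<noteq> f \<star> n" using c(2)[OF g] by blast
    have "f \<star> n = g \<star> n"
      using ini_inject[OF one Cantor_one[OF g] _ eq n(1)] suc_le_suc[OF n(1) c(1)] n(2) c(1) by simp
    then show ?thesis using n(3) by auto
  qed
  then show ?thesis using c(1) by (intro bexI[of _ "suc c"]) auto
qed

lemma fan_bounded:
  assumes FAN: "QF_FAN \<subseteq> T" and F: "F \<in> dom M two"
  shows "\<exists>c \<in> N. \<forall>f \<in> Cantor. F \<star> f \<preceq> c"
proof -
  let ?p = "(''p'', two)" and ?g = "(''g'', one)" and ?n = "(''n'', Nat)"
  have "\<exists>c \<in> N. \<forall>g \<in> Cantor. \<exists>n \<in> N. n \<preceq> c \<and>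
      sat M ((base(?p := F))(?g := g, ?n := n)) [] (V ?p \<cdot> V ?g \<doteq> V ?n)"
    by (rule fan_model[OF FAN]) (use F in \<open>auto dest: Cantor_one\<close>)
  then show ?thesis by auto
qed

section \<open>From pointwise to uniform moduli\<close>

definition origin :: 'a where "origin = const M (\<K> Nat Nat) \<star> zero"

lemma origin_app [simp]: "i \<in> N \<Longrightarrow> origin \<star> i = zero"
  by (simp add: origin_def)

lemma origin_in [simp]: "origin \<in> dom M one"
  unfolding origin_def by (rule ap_dom[OF const_in_dom(3)]) simp

lemma origin_Cantor: "origin \<in> Cantor" by (rule CantorI) simp_all

lemma trunc_below:
  "z \<in> dom M one \<Longrightarrow> k \<in> N \<Longrightarrow> i \<in> N \<Longrightarrow> suc i \<preceq> k \<Longrightarrow> trunc z k \<star> i = z \<star> i"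
  by simp

lemma trunc_cong:
  assumes f: "f \<in> dom M one" and g: "g \<in> dom M one" and k: "k \<in> N" and eq: "ini f k = ini g k"
  shows "trunc f k = trunc g k"
proof (rule extensional)
  show "trunc f k \<in> dom M one" "trunc g k \<in> dom M one" using f g k by simp_all
  fix i assume i: "i \<in> N"
  show "trunc f k \<star> i = trunc g k \<star> i"
  proof (cases "suc i \<preceq> k")
    case True
    then show ?thesis using ini_inject[OF f g k eq i] f g k i by simp
  next
    case False
    then show ?thesis using cond_pos[of "suc i \<ominus> k"] f g k i by simp
  qed
qed

lemma trunc_origin: "k \<in> N \<Longrightarrow> trunc origin k = origin"
proof (rule extensional)
  assume k: "k \<in> N"
  then show "trunc origin k \<in> dom M one" "origin \<in> dom M one" by simp_all
  show "trunc origin k \<star> i = origin \<star> i" if "i \<in> N" for i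
    using k that cond_pos[of "suc i \<ominus> k" zero zero] cond_zero[of zero zero]
    by (cases "suc i \<ominus> k = zero") (simp_all del: monus_eqs)
qed

lemma shift_origin: "k \<in> N \<Longrightarrow> shift origin k = origin"
proof (rule extensional)
  assume k: "k \<in> N"
  then show "shift origin k \<in> dom M one" "origin \<in> dom M one" by simp_all
  show "shift origin k \<star> i = origin \<star> i" if "i \<in> N" for i
    using k that by simp
qed

text \<open>
  Every element of Cantor space is the shift of a sequence that begins with \<open>k\<close> zeros.
\<close>

lemma ex_pad:
  assumes f: "f \<in> Cantor" and k: "k \<in> N"
  shows "\<exists>z \<in> Cantor. shift z k = f \<and> (\<forall>i \<in> N. suc i \<preceq> k \<longrightarrow> z \<star> i = zero)"
proof -
  note one = Cantor_one[OF f]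
  let ?f = "(''f'', one)" and ?k = "(''k'', Nat)" and ?i = "(''i'', Nat)"
  let ?t = "cond_tm \<cdot> (monus_tm \<cdot> (Succ \<cdot> V ?i) \<cdot> V ?k) \<cdot> Zero \<cdot> (V ?f \<cdot> (monus_tm \<cdot> V ?i \<cdot> V ?k))"
  obtain z where z: "z \<in> dom M one"
    and app: "\<And>i. i \<in> N \<Longrightarrow> z \<star> i = cond (suc i \<ominus> k) zero (f \<star> (i \<ominus> k))"
    using Lambda[of "base(?f := f, ?k := k)" ?t Nat ?i] one k by auto
  have "z \<in> Cantor"
    using z k one Cantor_cases[OF f] by (intro CantorI) (simp_all add: app cond_bit)
  moreover have "shift z k = f"
  proof (rule extensional)
    show "shift z k \<in> dom M one" "f \<in> dom M one" using z k one by simp_all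
    fix i assume i: "i \<in> N"
    have "suc (k \<oplus> i) \<ominus> k \<noteq> zero" using suc_le_iff[of "k \<oplus> i" k] le_plus[of k i] k i by auto
    moreover have "k \<oplus> i \<ominus> k = i" using plus_monus[of i k] plus_comm[of i k] k i by simp
    ultimately show "shift z k \<star> i = f \<star> i" using z k i one by (simp add: app cond_pos)
  qed
  moreover have "\<forall>i \<in> N. suc i \<preceq> k \<longrightarrow> z \<star> i = zero" using k one by (simp add: app del: monus_eqs)
  ultimately show ?thesis using z by blast
qed

text \<open>
  All functionals are continuous on Cantor space by the fan theorem, so \<open>\<Delta> \<phi>\<close> gives pointwise moduli
  for every \<open>\<phi>\<close>, and these are bounded by the fan theorem once more. Choice of such bounds as a
  function of \<open>\<phi>\<close> requires a quantifier-free matrix. It is \<open>\<Delta> (gap \<phi> k) 0 \<le> k\<close>: this implies that \<open>k\<close>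
  is a uniform modulus, and each \<open>\<phi>\<close> has a \<open>k\<close> that satisfies it.
\<close>

lemma MPC0_imp_MUC:
  assumes FAN: "QF_FAN \<subseteq> T" and AC: "QF_AC two \<subseteq> T"
    and e: "assignment M e" and MPC0: "sat M e [] MPC0"
  shows "sat M e [] MUC"
proof -
  obtain \<Delta> where \<Delta>: "\<Delta> \<in> dom M (two \<leadsto> one \<leadsto> Nat)"
    and mod: "\<And>\<phi> f g. \<phi> \<in> dom M two \<Longrightarrow> f \<in> Cantor \<Longrightarrow> g \<in> Cantor \<Longrightarrow>
      ini f (\<Delta> \<star> \<phi> \<star> f) = ini g (\<Delta> \<star> \<phi> \<star> f) \<Longrightarrow> \<phi> \<star> f = \<phi> \<star> g"
    using MPC0 fan_continuous[OF FAN] unfolding sat_MPC0[OF e] by blast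
  have \<Delta>1: "\<Delta> \<star> \<phi> \<in> dom M two" if "\<phi> \<in> dom M two" for \<phi> using ap_dom[OF \<Delta> that] .
  have \<Delta>2: "\<Delta> \<star> \<phi> \<star> f \<in> N" if "\<phi> \<in> dom M two" "f \<in> dom M one" for \<phi> f
    using ap_dom[OF \<Delta>1[OF that(1)] that(2)] .

  (* The pointwise modulus of the gap at zero lies below k. Padding f with k zeros therefore does not
     change the gap, which vanishes at zero; so f and its truncation at k have the same value. *)
  have sound: "\<phi> \<star> f = \<phi> \<star> g"
    if \<phi>: "\<phi> \<in> dom M two" and k: "k \<in> N" and le: "\<Delta> \<star> gap \<phi> k \<star> origin \<preceq> k"
      and f: "f \<in> Cantor" and g: "g \<in> Cantor" and eq: "ini f k = ini g k" for \<phi> k f g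
  proof -
    have trunc: "\<phi> \<star> f = \<phi> \<star> trunc f k" if f: "f \<in> Cantor" for f
    proof -
      note one = Cantor_one[OF f]
      obtain z where z: "z \<in> Cantor" "shift z k = f" "\<And>i. i \<in> N \<Longrightarrow> suc i \<preceq> k \<Longrightarrow> z \<star> i = zero"
        using ex_pad[OF f k] by blast
      let ?d = "\<Delta> \<star> gap \<phi> k \<star> origin"
      have d: "?d \<in> N" using \<Delta>2 \<phi> k by simp
      have "ini origin ?d = ini z ?d"
        using z(1,3) d k le le_trans[of _ ?d k] by (intro ini_cong) (auto dest: Cantor_one)
      then have "gap \<phi> k \<star> origin = gap \<phi> k \<star> z"
        using mod[of "gap \<phi> k" origin z] \<phi> k z(1) origin_Cantor by simp
      moreover have "gap \<phi> k \<star> origin = zero"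
        using \<phi> k by (simp add: gap_app clip_id origin_Cantor shift_origin trunc_origin dist_eq_zero)
      moreover have "gap \<phi> k \<star> z = cl dist_tm \<star> (\<phi> \<star> f) \<star> (\<phi> \<star> trunc f k)"
        using \<phi> k z Cantor_one[OF z(1)] by (simp add: gap_app clip_id)
      ultimately show ?thesis using dist_eq_zero[of "\<phi> \<star> f" "\<phi> \<star> trunc f k"] \<phi> k one by simp
    qed
    show ?thesis using trunc[OF f] trunc[OF g] trunc_cong[OF _ _ k eq] f g Cantor_one by simp
  qed

  have ex: "\<exists>k \<in> N. \<Delta> \<star> gap \<phi> k \<star> origin \<preceq> k" if \<phi>: "\<phi> \<in> dom M two" for \<phi>
  proof -
    obtain c where c: "c \<in> N" "\<And>f. f \<in> Cantor \<Longrightarrow> \<Delta> \<star> \<phi> \<star> f \<preceq> c"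
      using fan_bounded[OF FAN \<Delta>1[OF \<phi>]] by blast
    (* From c on, all gaps are the zero functional, so by extensionality \<Delta> has the same value on
       all of them. That value and c are added to obtain k. *)
    have zero: "gap \<phi> k \<star> z = zero" if k: "k \<in> N" "c \<preceq> k" and z: "z \<in> dom M one" for k z
    proof -
      let ?s = "shift (clip z) k"
      have s: "?s \<in> Cantor" "?s \<in> dom M one" using z k clip_Cantor shift_Cantor by simp_all
      let ?d = "\<Delta> \<star> \<phi> \<star> ?s"
      have d: "?d \<in> N" "?d \<preceq> k" using \<Delta>2[OF \<phi> s(2)] le_trans[of ?d c k] c s k by simp_all
      have "ini ?s ?d = ini (trunc ?s k) ?d"
      proof (rule ini_cong)
        fix i assume i: "i \<in> N" "suc i \<preceq> ?d"
        then have "suc i \<preceq> k" using le_trans[of "suc i" ?d k] d k by simp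
        then show "?s \<star> i = trunc ?s k \<star> i" using trunc_below[OF s(2) k(1) i(1)] by simp
      qed (use s k d in simp_all)
      then have "\<phi> \<star> ?s = \<phi> \<star> trunc ?s k"
        using mod[OF \<phi> s(1) trunc_Cantor[OF s(1) k(1)]] by simp
      then show ?thesis using \<phi> k z s by (simp add: gap_app dist_eq_zero)
    qed
    let ?d = "\<Delta> \<star> gap \<phi> c \<star> origin"
    have d: "?d \<in> N" using \<Delta>2 \<phi> c by simp
    have "gap \<phi> (c \<oplus> ?d) = gap \<phi> c"
    proof (rule extensional)
      show "gap \<phi> (c \<oplus> ?d) \<in> dom M two" "gap \<phi> c \<in> dom M two" using \<phi> c(1) d by simp_all
      show "gap \<phi> (c \<oplus> ?d) \<star> z = gap \<phi> c \<star> z" if "z \<in> dom M one" for z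
        using zero[OF _ _ that] c(1) d le_plus[of c ?d] le_refl[of c] by simp
    qed
    then show ?thesis using le_plus[of ?d c] plus_comm[of ?d c] c(1) d
      by (intro bexI[of _ "c \<oplus> ?d"]) simp_all
  qed

  let ?D = "(''D'', two \<leadsto> one \<leadsto> Nat)" and ?p = "(''p'', two)" and ?k = "(''k'', Nat)"
  let ?A = "monus_tm \<cdot> (V ?D \<cdot> (gap_tm \<cdot> V ?p \<cdot> V ?k) \<cdot> (\<K> Nat Nat \<cdot> Zero)) \<cdot> V ?k \<doteq> Zero"
  have sat: "sat M ((base(?D := \<Delta>))(?p := \<phi>, ?k := k)) [] ?A \<longleftrightarrow> \<Delta> \<star> gap \<phi> k \<star> origin \<preceq> k"
    for \<phi> k by (simp add: origin_def)
  have "\<exists>\<Omega> \<in> dom M three. \<forall>\<phi> \<in> dom M two. sat M ((base(?D := \<Delta>))(?p := \<phi>, ?k := \<Omega> \<star> \<phi>)) [] ?A"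
  proof (rule qf_choice[OF AC])
    show "\<exists>k \<in> N. sat M ((base(?D := \<Delta>))(?p := \<phi>, ?k := k)) [] ?A" if "\<phi> \<in> dom M two" for \<phi>
      unfolding sat by (rule ex[OF that])
  qed (use \<Delta> in simp_all)
  then obtain \<Omega> where \<Omega>: "\<Omega> \<in> dom M three"
    "\<And>\<phi>. \<phi> \<in> dom M two \<Longrightarrow> \<Delta> \<star> gap \<phi> (\<Omega> \<star> \<phi>) \<star> origin \<preceq> \<Omega> \<star> \<phi>"
    unfolding sat by blast
  show ?thesis
    unfolding sat_MUC[OF e] using \<Omega> sound ap_dom[OF \<Omega>(1)] by blast
qed

section \<open>From a uniform modulus functional to the fan theorem\<close>

text \<open>
  Changing the single value at position \<open>p\<close> leaves all initial segments of length at most \<open>p\<close> alone.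
\<close>

lemma ex_flip:
  assumes z: "z \<in> Cantor" and p: "p \<in> N"
  shows "\<exists>y \<in> Cantor. y \<star> p \<noteq> z \<star> p \<and> (\<forall>k \<in> N. k \<preceq> p \<longrightarrow> ini z k = ini y k)"
proof -
  note one = Cantor_one[OF z]
  let ?z = "(''z'', one)" and ?p = "(''p'', Nat)" and ?i = "(''i'', Nat)"
  let ?t = "cond_tm \<cdot> (dist_tm \<cdot> V ?i \<cdot> V ?p) \<cdot> (cond_tm \<cdot> (V ?z \<cdot> V ?i) \<cdot> (Succ \<cdot> Zero) \<cdot> Zero) \<cdot> (V ?z \<cdot> V ?i)"
  obtain y where y: "y \<in> dom M one"
    and app: "\<And>i. i \<in> N \<Longrightarrow>
      y \<star> i = cond (cl dist_tm \<star> i \<star> p) (cond (z \<star> i) (suc zero) zero) (z \<star> i)"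
    using Lambda[of "base(?z := z, ?p := p)" ?t Nat ?i] one p by auto
  have "y \<in> Cantor"
    using y p one Cantor_cases[OF z] by (intro CantorI) (simp_all add: app cond_bit)
  moreover have "y \<star> p \<noteq> z \<star> p"
    using Cantor_cases[OF z p] p one dist_eq_zero[of p p] by (auto simp: app)
  moreover have "ini z k = ini y k" if k: "k \<in> N" "k \<preceq> p" for k
  proof (rule ini_cong)
    fix i assume i: "i \<in> N" "suc i \<preceq> k"
    then have "suc i \<preceq> p" using le_trans[of "suc i" k p] k p by simp
    then have "i \<noteq> p" using suc_le_iff[of p p] le_refl[of p] p by auto
    then have "cl dist_tm \<star> i \<star> p \<noteq> zero" using i p dist_eq_zero by simp
    then show "z \<star> i = y \<star> i" using i p one by (simp add: app cond_pos)
  qed (use one y k in simp_all)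
  ultimately show ?thesis by blast
qed

text \<open>
  Let \<open>m\<close> be a uniform modulus of \<open>F\<close> and \<open>G z = z (F z + m)\<close>. Flipping \<open>z\<close> at the position
  \<open>q = F z + m\<close> does not change \<open>F z\<close>, because \<open>q\<close> is not below \<open>m\<close>, but it changes \<open>G z\<close>. Hence a
  uniform modulus of \<open>G\<close> exceeds \<open>q\<close>, and thereby bounds \<open>F z\<close>.
\<close>

lemma uniform_modulus_bounded:
  assumes \<Omega>: "\<Omega> \<in> dom M three"
    and mod: "\<And>\<phi> f g. \<phi> \<in> dom M two \<Longrightarrow> f \<in> Cantor \<Longrightarrow> g \<in> Cantor \<Longrightarrow>
      ini f (\<Omega> \<star> \<phi>) = ini g (\<Omega> \<star> \<phi>) \<Longrightarrow> \<phi> \<star> f = \<phi> \<star> g"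
    and F: "F \<in> dom M two"
  shows "\<exists>c \<in> N. \<forall>f \<in> Cantor. F \<star> f \<preceq> c"
proof -
  define m where "m = \<Omega> \<star> F"
  have m: "m \<in> N" using ap_dom[OF \<Omega> F] by (simp add: m_def)
  let ?p = "(''p'', two)" and ?m = "(''m'', Nat)" and ?z = "(''z'', one)"
  obtain G where G: "G \<in> dom M two" and app: "\<And>z. z \<in> dom M one \<Longrightarrow> G \<star> z = z \<star> (F \<star> z \<oplus> m)"
    using Lambda[of "base(?p := F, ?m := m)" "V ?z \<cdot> (add_tm \<cdot> (V ?p \<cdot> V ?z) \<cdot> V ?m)" Nat ?z] F m by auto
  define k where "k = \<Omega> \<star> G"
  have k: "k \<in> N" using ap_dom[OF \<Omega> G] by (simp add: k_def)
  have "F \<star> z \<preceq> k" if z: "z \<in> Cantor" for z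
  proof -
    define q where "q = F \<star> z \<oplus> m"
    have Fz: "F \<star> z \<in> N" using F Cantor_one[OF z] by simp
    have q: "q \<in> N" using Fz m by (simp add: q_def)
    obtain y where y: "y \<in> Cantor" "y \<star> q \<noteq> z \<star> q"
      and eq: "\<And>k. k \<in> N \<Longrightarrow> k \<preceq> q \<Longrightarrow> ini z k = ini y k"
      using ex_flip[OF z q] by blast
    have "m \<preceq> q" using le_plus[of m "F \<star> z"] plus_comm[of m "F \<star> z"] m Fz by (simp add: q_def)
    then have "F \<star> z = F \<star> y" using mod[OF F z y(1)] eq[OF m] by (simp add: m_def)
    then have "G \<star> z \<noteq> G \<star> y"
      using app[OF Cantor_one[OF z]] app[OF Cantor_one[OF y(1)]] y(2) by (simp add: q_def)
    then have "\<not> k \<preceq> q" using mod[OF G z y(1)] eq[OF k] by (auto simp: k_def)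
    then have "suc q \<preceq> k" using suc_le_iff[OF q k] by simp
    then have "q \<preceq> k" using le_trans[of q "suc q" k] le_suc[OF q] q k by simp
    then show ?thesis using le_trans[of "F \<star> z" q k] le_plus[OF Fz m] Fz q k by (simp add: q_def)
  qed
  then show ?thesis using k by blast
qed

text \<open>
  Choice of type-1 arguments needs a witness for all sequences, so the instance is first composed with
  the retraction onto Cantor space. The choice functional is then bounded on Cantor space.
\<close>

lemma MUC_imp_fan:
  assumes AC: "QF_AC one \<subseteq> T" and e: "assignment M e" and MUC: "sat M e [] MUC"
    and \<psi>: "\<psi> \<in> QF_FAN"
  shows "sat M e [] \<psi>"
proof -
  obtain A f n k where A: "quantifier_free A" "wff [] A"
    and f: "snd f = one" "snd n = Nat" "snd k = Nat" "k \<noteq> n" "k \<notin> fv A"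
    and \<psi>_eq: "\<psi> = ((\<^bold>\<forall>f. V f \<^bold>\<le>\<^sub>1 const_one \<^bold>\<longrightarrow> (\<^bold>\<exists>n. A)) \<^bold>\<longrightarrow>
      (\<^bold>\<exists>k. \<^bold>\<forall>f. V f \<^bold>\<le>\<^sub>1 const_one \<^bold>\<longrightarrow> (\<^bold>\<exists>n. V n \<^bold>\<le> V k \<^bold>\<and> A)))"
    using \<psi> unfolding QF_FAN_def by blast
  have fn: "f \<noteq> n" using f by auto
  have "\<exists>c \<in> N. \<forall>a \<in> Cantor. \<exists>b \<in> N. b \<preceq> c \<and> sat M (e(f := a, n := b)) [] A"
    if ex: "\<forall>a \<in> Cantor. \<exists>b \<in> N. sat M (e(f := a, n := b)) [] A"
  proof -
    let ?B = "A[f \<^bold>:= clip_tm \<cdot> V f]"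
    have sat: "sat M (e(f := a, n := b)) [] ?B = sat M (e(f := clip a, n := b)) [] A" for a b
    proof -
      have "e(f := a, n := b, f := clip a) = e(f := clip a, n := b)" using fn by auto
      then show ?thesis using A f fn by (simp add: sat_subst del: fun_upd_apply) (simp add: fn)
    qed
    have "\<exists>F \<in> dom M (one \<leadsto> Nat). \<forall>a \<in> dom M one. sat M (e(f := a, n := F \<star> a)) [] ?B"
    proof (rule qf_choice[OF AC])
      show "quantifier_free ?B" using A by (simp add: quantifier_free_subst)
      show "wff [] ?B" using A f by (intro wff_subst) simp_all
      show "\<exists>b \<in> N. sat M (e(f := a, n := b)) [] ?B" if "a \<in> dom M one" for a
        unfolding sat using ex clip_Cantor[OF that] by blast
    qed (use f fn e in simp_all)
    then obtain F where F: "F \<in> dom M two" "\<forall>a \<in> dom M one. sat M (e(f := clip a, n := F \<star> a)) [] A"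
      unfolding sat by blast
    obtain \<Omega> where \<Omega>: "\<Omega> \<in> dom M three"
      and mod: "\<And>\<phi> f g. \<phi> \<in> dom M two \<Longrightarrow> f \<in> Cantor \<Longrightarrow> g \<in> Cantor \<Longrightarrow>
        ini f (\<Omega> \<star> \<phi>) = ini g (\<Omega> \<star> \<phi>) \<Longrightarrow> \<phi> \<star> f = \<phi> \<star> g"
      using MUC unfolding sat_MUC[OF e] by blast
    obtain c where c: "c \<in> N" "\<forall>a \<in> Cantor. F \<star> a \<preceq> c"
      using uniform_modulus_bounded[OF \<Omega> mod F(1)] by blast
    have "sat M (e(f := a, n := F \<star> a)) [] A" if "a \<in> Cantor" for a
      using F(2) Cantor_one[OF that] clip_id[OF that] by metis
    then show ?thesis using c app_two_in[OF F(1)] Cantor_one by blast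
  qed
  then show ?thesis unfolding \<psi>_eq sat_fan[OF A(2) f] by blast
qed

text \<open>A uniform modulus is a pointwise one: \<open>\<Delta> \<phi> f = \<Omega> \<phi>\<close>.\<close>

lemma MUC_imp_MPC0:
  assumes e: "assignment M e" and MUC: "sat M e [] MUC"
  shows "sat M e [] MPC0"
proof -
  obtain \<Omega> where \<Omega>: "\<Omega> \<in> dom M three"
    and mod: "\<And>\<phi> f g. \<phi> \<in> dom M two \<Longrightarrow> f \<in> Cantor \<Longrightarrow> g \<in> Cantor \<Longrightarrow>
      ini f (\<Omega> \<star> \<phi>) = ini g (\<Omega> \<star> \<phi>) \<Longrightarrow> \<phi> \<star> f = \<phi> \<star> g"
    using MUC unfolding sat_MUC[OF e] by blast
  let ?W = "(''W'', three)" and ?p = "(''p'', two)" and ?f = "(''f'', one)"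
  obtain \<Delta> where \<Delta>: "\<Delta> \<in> dom M (two \<leadsto> one \<leadsto> Nat)"
    and app: "\<And>\<phi>. \<phi> \<in> dom M two \<Longrightarrow> \<Delta> \<star> \<phi> = val M (base(?W := \<Omega>, ?p := \<phi>)) [] (lam ?f (V ?W \<cdot> V ?p))"
    using Lambda[of "base(?W := \<Omega>)" "lam ?f (V ?W \<cdot> V ?p)" "one \<leadsto> Nat" ?p] \<Omega> by auto
  have \<Delta>_eq: "\<Delta> \<star> \<phi> \<star> f = \<Omega> \<star> \<phi>" if "\<phi> \<in> dom M two" "f \<in> Cantor" for \<phi> f
    using that \<Omega> by (simp add: app Cantor_one)
  show ?thesis
    unfolding sat_MPC0[OF e]
  proof (rule bexI[OF _ \<Delta>], intro ballI impI)
    fix \<phi> f g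
    assume \<phi>: "\<phi> \<in> dom M two" and fg: "f \<in> Cantor" "g \<in> Cantor"
      and "ini f (\<Delta> \<star> \<phi> \<star> f) = ini g (\<Delta> \<star> \<phi> \<star> f)"
    then have "ini f (\<Omega> \<star> \<phi>) = ini g (\<Omega> \<star> \<phi>)" by (simp only: \<Delta>_eq)
    then show "\<phi> \<star> f = \<phi> \<star> g" by (rule mod[OF \<phi> fg])
  qed
qed

end

section \<open>The equivalence\<close>

theorem corollary6p5:
  shows "(RCA0_omega \<union> QF_AC two \<union> QF_FAN \<turnstile> MPC0 \<^bold>\<longrightarrow> MUC) \<and>
         (\<forall>\<psi> \<in> QF_FAN \<union> {MPC0}. RCA0_omega \<union> QF_AC two \<turnstile> MUC \<^bold>\<longrightarrow> \<psi>)"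
proof (intro conjI ballI)
  let ?T = "RCA0_omega \<union> QF_AC two \<union> QF_FAN"
  have E_PRA: "E_PRA \<subseteq> ?T" by (auto simp: RCA0_omega_def)
  show "?T \<turnstile> MPC0 \<^bold>\<longrightarrow> MUC"
  proof (rule completeness[OF E_PRA])
    show "wff [] (MPC0 \<^bold>\<longrightarrow> MUC)" by (simp add: MUC_sentence MPC0_sentence)
    fix M :: "tm frame" and e assume M: "model M ?T" and e: "assignment M e"
    interpret arithmetic_model M ?T
      by (intro arithmetic_model.intro M arithmetic_model_axioms.intro E_PRA)
    show "sat M e [] (MPC0 \<^bold>\<longrightarrow> MUC)" using MPC0_imp_MUC e by auto
  qed
next
  let ?T = "RCA0_omega \<union> QF_AC two"
  have E_PRA: "E_PRA \<subseteq> ?T" by (auto simp: RCA0_omega_def)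
  fix \<psi> assume \<psi>: "\<psi> \<in> QF_FAN \<union> {MPC0}"
  show "?T \<turnstile> MUC \<^bold>\<longrightarrow> \<psi>"
  proof (rule completeness[OF E_PRA])
    show "wff [] (MUC \<^bold>\<longrightarrow> \<psi>)"
      using \<psi> wff_fan by (auto simp: MUC_sentence MPC0_sentence QF_FAN_def)
    fix M :: "tm frame" and e assume M: "model M ?T" and e: "assignment M e"
    interpret arithmetic_model M ?T
      by (intro arithmetic_model.intro M arithmetic_model_axioms.intro E_PRA)
    have "QF_AC one \<subseteq> ?T" by (auto simp: RCA0_omega_def)
    then show "sat M e [] (MUC \<^bold>\<longrightarrow> \<psi>)"
      using \<psi> MUC_imp_fan MUC_imp_MPC0 e by auto
  qed
qed

end
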